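(* Let $\alpha>0$, $w<0$, and let $P(t)=\sum_{k=0}^{\infty}a_k e^{2\pi i b_k t}$ with $\sum_k|a_k|<\infty$ and $b_k\geq 0$ for each $k$. Let $g(t)=\dfrac{P(t)}{t-iw}$. Then the Gabor system $\mathcal{G}(g;\alpha,1)=\{e^{2\pi i m t}g(t-\alpha n)\}_{m,n\in\mathbb{Z}}$ is a frame in $L^2(\mathbb{R})$ if and only if there exist constants $c,C>0$ such that for every $G\in L^2(\mathbb{R})$, $$c\|G\|_2^2\leq \sum_{m\in\mathbb{Z}}\int_0^{1/\alpha}\Big|\sum_{k=0}^{\infty}a_k A_k\big[G(\cdot+m+b_k)\big](t)\Big|^2dt\leq C\|G\|_2^2,$$ where for each $m,k$ the function $t\mapsto G(t+m+b_k)$ is regarded as an element of $L^2(0,\alpha^{-1})$ (i.e. restricted to $t\in[0,\alpha^{-1}]$).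
   Context: A system $\{g_j\}$ in $L^2(\mathbb{R})$ is a frame if there are $A,B>0$ with $A\|f\|^2\leq\sum_j|(f,g_j)|^2\leq B\|f\|^2$ for all $f\in L^2(\mathbb{R})$. For each $k$ let $b_k^{*}\in[0,\alpha^{-1})$ denote $b_k \bmod \alpha^{-1}$. The operator $A_k:L^2(0,\alpha^{-1})\to L^2(0,\alpha^{-1})$ is defined by $$A_k f(t)=\begin{cases} e^{-2\pi w b_k^{*}}f(t-b_k^{*}), & b_k^{*}<t\leq \alpha^{-1},\\ e^{-2\pi w (b_k^{*}-\alpha^{-1})}f(t-b_k^{*}+\alpha^{-1}), & 0\leq t\leq b_k^{*},\end{cases}$$ i.e. $A_k=M_{e^{-2\pi w t}}L_{b_k^*}M_{e^{2\pi w t}}$ where $M_\varphi$ is multiplication by $\varphi$ and $L_{b}$ is the circular shift by $b$ on $L^2(0,\alpha^{-1})$. *)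

theory Defs
  imports "HOL-Analysis.Analysis"
begin

definition L2 :: "(real \<Rightarrow> complex) \<Rightarrow> bool" where
  "L2 f \<longleftrightarrow> f \<in> borel_measurable lborel \<and> integrable lborel (\<lambda>x. (norm (f x))\<^sup>2)"

definition L2norm_sq :: "(real \<Rightarrow> complex) \<Rightarrow> real" where
  "L2norm_sq f = (LINT x|lborel. (norm (f x))\<^sup>2)"

definition L2inner :: "(real \<Rightarrow> complex) \<Rightarrow> (real \<Rightarrow> complex) \<Rightarrow> complex" where
  "L2inner f g = (LINT x|lborel. f x * cnj (g x))"

definition frame :: "('i \<Rightarrow> real \<Rightarrow> complex) \<Rightarrow> bool" where
  "frame gs \<longleftrightarrow> (\<exists>A B. A > 0 \<and> B > 0 \<and> (\<forall>f. L2 f \<longrightarrow>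
     ennreal (A * L2norm_sq f) \<le> (\<integral>\<^sup>+ j. ennreal ((norm (L2inner f (gs j)))\<^sup>2) \<partial>count_space UNIV) \<and>
     (\<integral>\<^sup>+ j. ennreal ((norm (L2inner f (gs j)))\<^sup>2) \<partial>count_space UNIV) \<le> ennreal (B * L2norm_sq f)))"

definition gabor :: "(real \<Rightarrow> complex) \<Rightarrow> real \<Rightarrow> int \<Rightarrow> int \<Rightarrow> real \<Rightarrow> complex" where
  "gabor g \<alpha> m n t = exp (complex_of_real (2 * pi * real_of_int m * t) * \<i>) * g (t - \<alpha> * real_of_int n)"

definition bstar :: "real \<Rightarrow> real \<Rightarrow> real" where
  "bstar \<alpha> b = b - real_of_int \<lfloor>b * \<alpha>\<rfloor> / \<alpha>"

text \<open>The operator A_k on L^2(0, alpha^{-1}) (functions are only evaluated on [0, alpha^{-1}];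
  the result is set to 0 outside [0, alpha^{-1}]).\<close>
definition A_op :: "real \<Rightarrow> real \<Rightarrow> real \<Rightarrow> (real \<Rightarrow> complex) \<Rightarrow> real \<Rightarrow> complex" where
  "A_op \<alpha> w b f t =
     (let bs = bstar \<alpha> b in
      if bs < t \<and> t \<le> 1 / \<alpha> then complex_of_real (exp (- 2 * pi * w * bs)) * f (t - bs)
      else if 0 \<le> t \<and> t \<le> bs then complex_of_real (exp (- 2 * pi * w * (bs - 1 / \<alpha>))) * f (t - bs + 1 / \<alpha>)
      else 0)"

end

(*
  With u = 1/\<alpha>, the function 1/(t - iw) is the Fourier transform of a one-sided exponential
  supported on a half line, so the Fourier transform of g is a constant times
  p(x) = \<Sum> a_k exp(2 pi w (x - b_k)) [x > b_k], and the Gabor system is a frame iff the transformed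
  system gh_mn(x) = p(x - m) exp(-2 pi i \<alpha> n (x - m)) is. Since q = exp(2 pi w u) < 1, the operator
  G \<mapsto> G - q G(. + u) is bounded above and below and has dense range, so it suffices to test
  with (conjugates of) functions of this form. After a translation by u the coefficient with
  gh_mn is, up to a constant and conjugation, the integral of G(x + m) (p(x) - q p(x - u)) exp(-2 pi i \<alpha> n x), where
  p(x) - q p(x - u) = \<Sum> a_k exp(2 pi w (x - b_k)) [b_k < x <= b_k + u]. Wrapping the interval
  (b_k, b_k + u] around modulo u turns the k-th term into exp(2 pi w t) A_k[G(. + m + b_k)](t) on
  (0, u), and Parseval for Fourier series on (0, u) sums the squares over n.

  The Fourier transform on L2 is never constructed: frame bounds may be tested on a dense set, and
  it is enough to use pairs of integrable functions that satisfy Fourier inversion pointwise; for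
  these, Parseval's identity is Fubini's theorem. The pairs are dense because they contain
  Gaussians times trigonometric polynomials.
*)
theory Submission
  imports Defs "HOL-Probability.Probability"
begin

section \<open>Square-integrable functions\<close>

text \<open>The combination p - q p(. - u) answers two obstacles. The exponentials exp(-2 pi i
  \<alpha> n x) have period u, so Parseval applies only after folding onto one period; and the terms
  of p have infinite tails. Every term decays by the same factor q over a length u, so subtracting q
  times the translate cuts each tail off after exactly one period, whatever b_k is. Moving the
  translation onto G by a change of variable produces G - q G(. + u). The weight exp(2 pi w t) left
  over on (0, u) lies between q and 1 and costs only constants.

  The window need not be integrable (1/(t - iw) is not). This fixes the direction of the transform:
  g is written as the transform of an integrable function, and Parseval asks for integrability only
  on that side.

  Absolute summability of a_k serves as a weight: if the functions f_k have uniformly bounded L^2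
  norms, then the sum of |a_k| |f_k|^2 has finite integral, so the series of a_k f_k converges at
  almost every point. This is what gives sense to the pointwise series in the theorem.\<close>

lemma L2_measurable [measurable_dest]: "L2 f \<Longrightarrow> f \<in> borel_measurable borel"
  by (simp add: L2_def)

lemma L2_integrable: "L2 f \<Longrightarrow> integrable lborel (\<lambda>x. (norm (f x))\<^sup>2)"
  by (simp add: L2_def)

lemma L2norm_sq_nonneg [simp]: "0 \<le> L2norm_sq f"
  by (simp add: L2norm_sq_def)

lemma norm_add_sq_le: "(norm (x + y))\<^sup>2 \<le> 2 * (norm x)\<^sup>2 + 2 * (norm y)\<^sup>2"
  for x y :: "'a::real_normed_vector"
proof -
  have "(norm (x + y))\<^sup>2 \<le> (norm x + norm y)\<^sup>2"
    by (simp add: norm_triangle_ineq power_mono)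
  also have "\<dots> \<le> 2 * (norm x)\<^sup>2 + 2 * (norm y)\<^sup>2"
    using sum_squares_bound[of "norm x" "norm y"] by (simp add: power2_sum)
  finally show ?thesis .
qed

lemma norm_diff_sq_le: "(norm (x - y))\<^sup>2 \<le> 2 * (norm x)\<^sup>2 + 2 * (norm y)\<^sup>2"
  for x y :: "'a::real_normed_vector"
  using norm_add_sq_le[of x "- y"] by simp

lemma L2_bound_AE:
  assumes "f \<in> borel_measurable borel" "integrable lborel h" "AE x in lborel. (norm (f x))\<^sup>2 \<le> h x"
  shows "L2 f"
proof -
  have [measurable]: "f \<in> borel_measurable borel" by fact
  have "integrable lborel (\<lambda>x. (norm (f x))\<^sup>2)"
  proof (rule Bochner_Integration.integrable_bound[OF assms(2)])
    show "AE x in lborel. norm ((norm (f x))\<^sup>2) \<le> norm (h x)"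
      using assms(3) by eventually_elim simp
  qed measurable
  then show ?thesis by (simp add: L2_def)
qed

lemma L2_bound:
  assumes "f \<in> borel_measurable borel" "integrable lborel h" "\<And>x. (norm (f x))\<^sup>2 \<le> h x"
  shows "L2 f" "L2norm_sq f \<le> integral\<^sup>L lborel h"
proof -
  show f: "L2 f" by (rule L2_bound_AE[OF assms(1,2)]) (simp add: assms(3))
  show "L2norm_sq f \<le> integral\<^sup>L lborel h"
    unfolding L2norm_sq_def by (rule integral_mono[OF _ assms(2,3)]) (use f in \<open>simp add: L2_def\<close>)
qed

text \<open>The factor 2 stands in for Minkowski's inequality: the development works with squared
  norms, and the frame property tolerates constant losses.\<close>

lemma L2_add:
  assumes f: "L2 f" and g: "L2 g"
  shows "L2 (\<lambda>x. f x + g x)"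
    and "L2norm_sq (\<lambda>x. f x + g x) \<le> 2 * L2norm_sq f + 2 * L2norm_sq g"
proof -
  note [measurable] = L2_measurable[OF f] L2_measurable[OF g]
  have i: "integrable lborel (\<lambda>x. 2 * (norm (f x))\<^sup>2 + 2 * (norm (g x))\<^sup>2)"
    using L2_integrable[OF f] L2_integrable[OF g] by simp
  have m: "(\<lambda>x. f x + g x) \<in> borel_measurable borel" by measurable
  note B = L2_bound[OF m i norm_add_sq_le]
  show "L2 (\<lambda>x. f x + g x)" by (rule B)
  show "L2norm_sq (\<lambda>x. f x + g x) \<le> 2 * L2norm_sq f + 2 * L2norm_sq g"
    using B(2) L2_integrable[OF f] L2_integrable[OF g] by (simp add: L2norm_sq_def)
qed

lemma L2_cmult:
  assumes f: "L2 f"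
  shows "L2 (\<lambda>x. c * f x)" "L2norm_sq (\<lambda>x. c * f x) = (norm c)\<^sup>2 * L2norm_sq f"
proof -
  note [measurable] = L2_measurable[OF f]
  show "L2 (\<lambda>x. c * f x)" using L2_integrable[OF f]
    by (simp add: L2_def norm_mult power_mult_distrib)
  show "L2norm_sq (\<lambda>x. c * f x) = (norm c)\<^sup>2 * L2norm_sq f"
    by (simp add: L2norm_sq_def norm_mult power_mult_distrib)
qed

lemma L2_uminus: "L2 f \<Longrightarrow> L2 (\<lambda>x. - f x)" and L2norm_sq_uminus: "L2norm_sq (\<lambda>x. - f x) = L2norm_sq f"
  by (auto simp: L2_def L2norm_sq_def)

lemma L2_diff:
  assumes f: "L2 f" and g: "L2 g"
  shows "L2 (\<lambda>x. f x - g x)"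
    and "L2norm_sq (\<lambda>x. f x - g x) \<le> 2 * L2norm_sq f + 2 * L2norm_sq g"
  using L2_add[OF f L2_uminus[OF g]] by (simp_all add: L2norm_sq_uminus)

lemma measurable_cnj [measurable]: "cnj \<in> borel_measurable borel"
  by (intro borel_measurable_continuous_onI continuous_intros)

lemma L2_cnj: "L2 f \<Longrightarrow> L2 (\<lambda>x. cnj (f x))" and L2norm_sq_cnj: "L2norm_sq (\<lambda>x. cnj (f x)) = L2norm_sq f"
  by (auto simp: L2_def L2norm_sq_def)

lemma L2norm_sq_diff_commute: "L2norm_sq (\<lambda>x. f x - g x) = L2norm_sq (\<lambda>x. g x - f x)"
  by (simp add: L2norm_sq_def norm_minus_commute)

lemma L2_zero: "L2 (\<lambda>x. 0)"
  by (simp add: L2_def)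

lemma L2_sum: "finite J \<Longrightarrow> (\<And>j. j \<in> J \<Longrightarrow> L2 (f j)) \<Longrightarrow> L2 (\<lambda>x. \<Sum>j\<in>J. f j x)"
  by (induction J rule: finite_induct) (auto simp: L2_zero intro!: L2_add)

lemma L2_shift:
  assumes f: "L2 f"
  shows "L2 (\<lambda>x. f (x + c))" "L2norm_sq (\<lambda>x. f (x + c)) = L2norm_sq f"
proof -
  note [measurable] = L2_measurable[OF f]
  have "integrable lborel (\<lambda>x. (norm (f (c + 1 * x)))\<^sup>2)"
    by (rule lborel_integrable_real_affine[OF L2_integrable[OF f], of 1 c]) simp
  then show "L2 (\<lambda>x. f (x + c))"
    by (simp add: L2_def add.commute)
  show "L2norm_sq (\<lambda>x. f (x + c)) = L2norm_sq f"
    unfolding L2norm_sq_def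
    using lborel_integral_real_affine[of 1 "\<lambda>x. (norm (f x))\<^sup>2" c] by (simp add: add.commute)
qed

lemma L2_mult_bounded:
  assumes f: "L2 f" and [measurable]: "k \<in> borel_measurable borel" and K: "\<And>x. norm (k x) \<le> K"
  shows "L2 (\<lambda>x. k x * f x)" "L2norm_sq (\<lambda>x. k x * f x) \<le> K\<^sup>2 * L2norm_sq f"
proof -
  note [measurable] = L2_measurable[OF f]
  have m: "(\<lambda>x. k x * f x) \<in> borel_measurable borel" by measurable
  have i: "integrable lborel (\<lambda>x. K\<^sup>2 * (norm (f x))\<^sup>2)" using L2_integrable[OF f] by simp
  have b: "(norm (k x * f x))\<^sup>2 \<le> K\<^sup>2 * (norm (f x))\<^sup>2" for x
    unfolding norm_mult power_mult_distrib
    by (intro mult_right_mono power_mono K) auto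
  note B = L2_bound[OF m i b]
  show "L2 (\<lambda>x. k x * f x)" by (rule B)
  show "L2norm_sq (\<lambda>x. k x * f x) \<le> K\<^sup>2 * L2norm_sq f" using B(2) by (simp add: L2norm_sq_def)
qed

lemma L2_inner_integrable:
  assumes f: "L2 f" and g: "L2 g"
  shows "integrable lborel (\<lambda>x. f x * cnj (g x))"
proof (rule Bochner_Integration.integrable_bound)
  note [measurable] = L2_measurable[OF f] L2_measurable[OF g] L2_measurable[OF L2_cnj[OF g]]
  show "integrable lborel (\<lambda>x. (norm (f x))\<^sup>2 + (norm (g x))\<^sup>2)"
    using L2_integrable[OF f] L2_integrable[OF g] by simp
  show "(\<lambda>x. f x * cnj (g x)) \<in> borel_measurable lborel" by measurable
  have "norm (f x * cnj (g x)) \<le> (norm (f x))\<^sup>2 + (norm (g x))\<^sup>2" for x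
    using sum_squares_bound[of "norm (f x)" "norm (g x)"]
      mult_nonneg_nonneg[OF norm_ge_zero[of "f x"] norm_ge_zero[of "g x"]]
    unfolding norm_mult complex_mod_cnj by linarith
  then show "AE x in lborel. norm (f x * cnj (g x)) \<le> norm ((norm (f x))\<^sup>2 + (norm (g x))\<^sup>2)"
    by simp
qed

lemma L2inner_add_left:
  "L2 f \<Longrightarrow> L2 g \<Longrightarrow> L2 h \<Longrightarrow> L2inner (\<lambda>x. f x + g x) h = L2inner f h + L2inner g h"
  unfolding L2inner_def distrib_right
  by (intro Bochner_Integration.integral_add L2_inner_integrable)

lemma L2inner_diff_left:
  "L2 f \<Longrightarrow> L2 g \<Longrightarrow> L2 h \<Longrightarrow> L2inner (\<lambda>x. f x - g x) h = L2inner f h - L2inner g h"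
  unfolding L2inner_def left_diff_distrib
  by (intro Bochner_Integration.integral_diff L2_inner_integrable)

lemma L2inner_cmult_left: "L2inner (\<lambda>x. c * f x) h = c * L2inner f h"
  unfolding L2inner_def mult.assoc by (rule integral_mult_right_zero)

lemma L2inner_sum_left:
  assumes "finite J" "\<And>j. j \<in> J \<Longrightarrow> L2 (f j)" "L2 h"
  shows "L2inner (\<lambda>x. \<Sum>j\<in>J. f j x) h = (\<Sum>j\<in>J. L2inner (f j) h)"
  unfolding L2inner_def sum_distrib_right
  by (rule Bochner_Integration.integral_sum) (use assms in \<open>auto intro: L2_inner_integrable\<close>)

lemma L2inner_cnj: "cnj (L2inner f g) = L2inner g f"
proof -
  have "cnj (L2inner f g) = (LINT x|lborel. cnj (f x * cnj (g x)))"
    unfolding L2inner_def by (rule Bochner_Integration.integral_cnj[symmetric])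
  then show ?thesis by (simp only: L2inner_def complex_cnj_mult complex_cnj_cnj mult.commute)
qed

lemma L2inner_self: "L2inner f f = complex_of_real (L2norm_sq f)"
  unfolding L2inner_def L2norm_sq_def integral_complex_of_real[symmetric]
  by (simp only: complex_norm_square)

lemma L2norm_sq_diff:
  assumes f: "L2 f" and g: "L2 g"
  shows "L2norm_sq (\<lambda>x. f x - g x) = L2norm_sq f + L2norm_sq g - 2 * Re (L2inner f g)"
proof -
  have d: "L2 (\<lambda>x. f x - g x)" by (rule L2_diff[OF f g])
  have 1: "L2inner (\<lambda>x. f x - g x) h = L2inner f h - L2inner g h" if "L2 h" for h
    by (rule L2inner_diff_left[OF f g that])
  have 2: "L2inner h (\<lambda>x. f x - g x) = L2inner h f - L2inner h g" if "L2 h" for h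
    using arg_cong[OF 1[OF that], of cnj] by (simp add: L2inner_cnj)
  have "L2inner (\<lambda>x. f x - g x) (\<lambda>x. f x - g x) = L2inner f f - L2inner f g - (L2inner g f - L2inner g g)"
    by (simp add: 1[OF d] 2[OF f] 2[OF g])
  then have "complex_of_real (L2norm_sq (\<lambda>x. f x - g x)) =
      L2inner f f + L2inner g g - (L2inner f g + cnj (L2inner f g))"
    by (simp add: L2inner_self L2inner_cnj algebra_simps)
  then have "Re (complex_of_real (L2norm_sq (\<lambda>x. f x - g x))) = Re (L2inner f f + L2inner g g - (L2inner f g + cnj (L2inner f g)))"
    by simp
  then show ?thesis by (simp add: L2inner_self)
qed

lemma L2_Cauchy_Schwarz:
  assumes f: "L2 f" and g: "L2 g"
  shows "(norm (L2inner f g))\<^sup>2 \<le> L2norm_sq f * L2norm_sq g"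
proof (cases "L2norm_sq g = 0")
  case False
  then have pos: "L2norm_sq g > 0" using L2norm_sq_nonneg[of g] by linarith
  \<comment> \<open>The coefficient of the orthogonal projection of \<open>f\<close> onto
    \<open>g\<close>; the squared norm of the residual being nonnegative is then the claim.\<close>
  define c where "c = L2inner f g / complex_of_real (L2norm_sq g)"
  have "L2norm_sq (\<lambda>x. f x - c * g x) \<ge> 0" by simp
  moreover have "L2norm_sq (\<lambda>x. f x - c * g x) =
      L2norm_sq f + (norm c)\<^sup>2 * L2norm_sq g - 2 * Re (L2inner f (\<lambda>x. c * g x))"
    by (simp add: L2norm_sq_diff[OF f L2_cmult(1)[OF g]] L2_cmult(2)[OF g])
  moreover have "L2inner f (\<lambda>x. c * g x) = cnj c * L2inner f g"
    by (metis L2inner_cmult_left L2inner_cnj complex_cnj_mult)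
  moreover have "cnj c * L2inner f g = complex_of_real ((norm (L2inner f g))\<^sup>2 / L2norm_sq g)"
    unfolding of_real_divide complex_norm_square c_def by simp
  moreover have "(norm c)\<^sup>2 * L2norm_sq g = (norm (L2inner f g))\<^sup>2 / L2norm_sq g"
    using pos by (simp add: c_def norm_divide power_divide field_simps power2_eq_square)
  ultimately have "(norm (L2inner f g))\<^sup>2 / L2norm_sq g \<le> L2norm_sq f" by simp
  then show ?thesis using pos by (simp add: field_simps)
next
  case True
  have "AE x in lborel. (norm (g x))\<^sup>2 = 0"
    using True integral_nonneg_eq_0_iff_AE[OF L2_integrable[OF g]] by (simp add: L2norm_sq_def)
  then have "AE x in lborel. f x * cnj (g x) = 0" by eventually_elim simp
  then have "L2inner f g = 0"
    unfolding L2inner_def by (rule integral_eq_zero_AE)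
  then show ?thesis using True by simp
qed

lemma L2_tendsto_zero:
  fixes f :: "nat \<Rightarrow> real \<Rightarrow> complex"
  assumes [measurable]: "\<And>n. f n \<in> borel_measurable borel" and "integrable lborel h"
    and "AE x in lborel. (\<lambda>n. f n x) \<longlonglongrightarrow> 0"
    and "\<And>n x. (norm (f n x))\<^sup>2 \<le> h x"
  shows "(\<lambda>n. L2norm_sq (f n)) \<longlonglongrightarrow> 0"
proof -
  have [measurable]: "h \<in> borel_measurable lborel" using assms(2) by auto
  have "(\<lambda>n. L2norm_sq (f n)) \<longlonglongrightarrow> (LINT (x::real)|lborel. (0::real))"
    unfolding L2norm_sq_def
  proof (rule Bochner_Integration.integral_dominated_convergence[where w=h])
    show "AE x in lborel. (\<lambda>i. (cmod (f i x))\<^sup>2) \<longlonglongrightarrow> 0"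
      using assms(3) by eventually_elim (auto intro!: tendsto_eq_intros)
    show "AE x in lborel. norm ((cmod (f i x))\<^sup>2) \<le> h x" for i
      using assms(4) by simp
  qed (use assms in auto)
  then show ?thesis by simp
qed

section \<open>Dense sets and frame bounds tested on them\<close>

definition L2_dense :: "(real \<Rightarrow> complex) set \<Rightarrow> bool" where
  "L2_dense D \<longleftrightarrow> (\<forall>d\<in>D. L2 d) \<and> (\<forall>f \<epsilon>. L2 f \<longrightarrow> 0 < \<epsilon> \<longrightarrow> (\<exists>d\<in>D. L2norm_sq (\<lambda>x. f x - d x) < \<epsilon>))"

text \<open>Valued in \<open>ennreal\<close>, so a divergent sum is the value infinity and an upper
  bound by a real number asserts convergence as well.\<close>

definition frame_sum :: "('i \<Rightarrow> real \<Rightarrow> complex) \<Rightarrow> (real \<Rightarrow> complex) \<Rightarrow> ennreal" where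
  "frame_sum gs f = (\<integral>\<^sup>+ j. ennreal ((norm (L2inner f (gs j)))\<^sup>2) \<partial>count_space UNIV)"

definition frame_on :: "(real \<Rightarrow> complex) set \<Rightarrow> ('i \<Rightarrow> real \<Rightarrow> complex) \<Rightarrow> bool" where
  "frame_on D gs \<longleftrightarrow> (\<exists>A B. A > 0 \<and> B > 0 \<and> (\<forall>f\<in>D.
     ennreal (A * L2norm_sq f) \<le> frame_sum gs f \<and> frame_sum gs f \<le> ennreal (B * L2norm_sq f)))"

lemma frame_eq_frame_on: "frame gs \<longleftrightarrow> frame_on (Collect L2) gs"
  by (simp add: frame_def frame_on_def frame_sum_def)

lemma frame_sum_add_le:
  assumes "L2 f" "L2 h" "\<And>j. L2 (gs j)"
  shows "frame_sum gs (\<lambda>x. f x + h x) \<le> 2 * frame_sum gs f + 2 * frame_sum gs h"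
proof -
  have "frame_sum gs (\<lambda>x. f x + h x) \<le>
      (\<integral>\<^sup>+ j. 2 * ennreal ((norm (L2inner f (gs j)))\<^sup>2) + 2 * ennreal ((norm (L2inner h (gs j)))\<^sup>2) \<partial>count_space UNIV)"
    unfolding frame_sum_def
  proof (rule nn_integral_mono)
    fix j
    have "ennreal ((norm (L2inner (\<lambda>x. f x + h x) (gs j)))\<^sup>2) \<le>
       ennreal (2 * (norm (L2inner f (gs j)))\<^sup>2 + 2 * (norm (L2inner h (gs j)))\<^sup>2)"
      by (simp only: L2inner_add_left[OF assms(1,2,3)]) (intro ennreal_leI norm_add_sq_le)
    also have "\<dots> = 2 * ennreal ((norm (L2inner f (gs j)))\<^sup>2) + 2 * ennreal ((norm (L2inner h (gs j)))\<^sup>2)"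
      by (simp add: ennreal_mult' )
    finally show "ennreal ((norm (L2inner (\<lambda>x. f x + h x) (gs j)))\<^sup>2) \<le>
       2 * ennreal ((norm (L2inner f (gs j)))\<^sup>2) + 2 * ennreal ((norm (L2inner h (gs j)))\<^sup>2)" .
  qed
  also have "\<dots> = 2 * frame_sum gs f + 2 * frame_sum gs h"
    by (simp add: frame_sum_def nn_integral_add nn_integral_cmult)
  finally show ?thesis .
qed

lemma L2inner_tendsto:
  assumes "\<And>n. L2 (d n)" "L2 f" "L2 g" and lim: "(\<lambda>n. L2norm_sq (\<lambda>x. f x - d n x)) \<longlonglongrightarrow> 0"
  shows "(\<lambda>n. L2inner (d n) g) \<longlonglongrightarrow> L2inner f g"
proof -
  have "(\<lambda>n. (norm (L2inner f g - L2inner (d n) g))\<^sup>2) \<longlonglongrightarrow> 0"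
  proof (rule tendsto_sandwich[OF always_eventually always_eventually tendsto_const])
    show "\<forall>n. (norm (L2inner f g - L2inner (d n) g))\<^sup>2 \<le> L2norm_sq (\<lambda>x. f x - d n x) * L2norm_sq g"
      using assms by (simp add: L2inner_diff_left[symmetric] L2_Cauchy_Schwarz L2_diff)
    show "(\<lambda>n. L2norm_sq (\<lambda>x. f x - d n x) * L2norm_sq g) \<longlonglongrightarrow> 0"
      using tendsto_mult_right[OF lim, of "L2norm_sq g"] by simp
  qed auto
  then have "(\<lambda>n. L2inner f g - L2inner (d n) g) \<longlonglongrightarrow> 0"
    by (auto dest: tendsto_real_sqrt intro: tendsto_norm_zero_cancel)
  from tendsto_diff[OF tendsto_const[of "L2inner f g"] this] show ?thesis by simp
qed

lemma L2_dense_sequence: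
  assumes "L2_dense D" "L2 f"
  obtains d where "\<And>n. d n \<in> D" "(\<lambda>n. L2norm_sq (\<lambda>x. f x - d n x)) \<longlonglongrightarrow> 0"
proof -
  have "\<forall>n. \<exists>d\<in>D. L2norm_sq (\<lambda>x. f x - d x) < inverse (real (Suc n))"
    using assms by (simp add: L2_dense_def)
  then obtain d where d: "\<And>n. d n \<in> D" "\<And>n. L2norm_sq (\<lambda>x. f x - d n x) < inverse (real (Suc n))"
    by metis
  have "(\<lambda>n. L2norm_sq (\<lambda>x. f x - d n x)) \<longlonglongrightarrow> 0"
    by (rule tendsto_sandwich[OF always_eventually always_eventually tendsto_const LIMSEQ_inverse_real_of_nat])
       (use d(2) in \<open>auto intro: less_imp_le\<close>)
  with d(1) show ?thesis by (rule that)
qed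

lemma L2norm_sq_le_approx:
  assumes "L2 f" "L2 d"
  shows "L2norm_sq f \<le> 2 * L2norm_sq d + 2 * L2norm_sq (\<lambda>x. f x - d x)"
  using L2_add(2)[OF assms(2) L2_diff(1)[OF assms]] by simp

text \<open>Along d_n tending to f every coefficient converges, so Fatou's lemma over the index set
  carries the upper bound from \<open>D\<close> to f. Fatou gives nothing for the lower bound; there
  the new upper bound is applied to the error d_n - f. The losses 2B and A/4 come from the factor 2
  in the inequalities for sums.\<close>

lemma frame_on_dense:
  assumes D: "L2_dense D" and gs: "\<And>j. L2 (gs j)"
  shows "frame gs \<longleftrightarrow> frame_on D gs"
proof
  assume "frame gs"
  then show "frame_on D gs"
    using D unfolding frame_eq_frame_on frame_on_def L2_dense_def by (metis mem_Collect_eq)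
next
  assume "frame_on D gs"
  then obtain A B where A: "A > 0" and B: "B > 0"
    and lo: "\<And>f. f \<in> D \<Longrightarrow> ennreal (A * L2norm_sq f) \<le> frame_sum gs f"
    and up: "\<And>f. f \<in> D \<Longrightarrow> frame_sum gs f \<le> ennreal (B * L2norm_sq f)"
    unfolding frame_on_def by blast
  have up': "frame_sum gs f \<le> ennreal (2 * B * L2norm_sq f)" if f: "L2 f" for f
  proof -
    obtain d where dD: "\<And>n. d n \<in> D" and lim: "(\<lambda>n. L2norm_sq (\<lambda>x. f x - d n x)) \<longlonglongrightarrow> 0"
      using L2_dense_sequence[OF D f] by blast
    have d: "L2 (d n)" for n using dD D by (auto simp: L2_dense_def)
    have "ennreal ((norm (L2inner f (gs j)))\<^sup>2) = liminf (\<lambda>n. ennreal ((norm (L2inner (d n) (gs j)))\<^sup>2))" for j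
      by (intro lim_imp_Liminf[symmetric] tendsto_ennrealI tendsto_power tendsto_norm
          L2inner_tendsto d f gs lim) simp
    then have "frame_sum gs f \<le> liminf (\<lambda>n. frame_sum gs (d n))"
      unfolding frame_sum_def by (simp only:) (intro nn_integral_liminf, simp)
    also have "\<dots> \<le> liminf (\<lambda>n. ennreal (B * (2 * L2norm_sq f + 2 * L2norm_sq (\<lambda>x. f x - d n x))))"
    proof (intro Liminf_mono always_eventually allI)
      fix n
      have "L2norm_sq (d n) \<le> 2 * L2norm_sq f + 2 * L2norm_sq (\<lambda>x. d n x - f x)"
        by (rule L2norm_sq_le_approx[OF d f])
      then show "frame_sum gs (d n) \<le> ennreal (B * (2 * L2norm_sq f + 2 * L2norm_sq (\<lambda>x. f x - d n x)))"
        using B by (intro order_trans[OF up[OF dD]] ennreal_leI mult_left_mono)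
          (simp_all add: L2norm_sq_diff_commute[of f])
    qed
    also have "\<dots> = ennreal (B * (2 * L2norm_sq f + 2 * 0))"
      by (intro lim_imp_Liminf tendsto_ennrealI tendsto_mult tendsto_add tendsto_const lim) simp
    finally show ?thesis by (simp add: ac_simps)
  qed
  have lo': "ennreal (A / 4 * L2norm_sq f) \<le> frame_sum gs f" if f: "L2 f" for f
  proof -
    obtain d where dD: "\<And>n. d n \<in> D" and lim: "(\<lambda>n. L2norm_sq (\<lambda>x. f x - d n x)) \<longlonglongrightarrow> 0"
      using L2_dense_sequence[OF D f] by blast
    have d: "L2 (d n)" for n using dD D by (auto simp: L2_dense_def)
    \<comment> \<open>Finiteness turns the comparison into one between real numbers, where the error
      term can be sent to zero.\<close>
    have "frame_sum gs f \<noteq> \<infinity>" using up'[OF f] by (auto simp: top_unique)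
    then obtain s where s: "frame_sum gs f = ennreal s" "s \<ge> 0"
      by (cases "frame_sum gs f") auto
    have bd: "A * L2norm_sq f \<le> 4 * s + (8 * B + 2 * A) * L2norm_sq (\<lambda>x. f x - d n x)" for n
    proof -
      let ?e = "\<lambda>x. d n x - f x"
      have e: "L2 ?e" by (intro L2_diff d f)
      have "ennreal (A * L2norm_sq (d n)) \<le> frame_sum gs (\<lambda>x. f x + ?e x)"
        using lo[OF dD] by simp
      also have "\<dots> \<le> 2 * frame_sum gs f + 2 * frame_sum gs ?e"
        by (rule frame_sum_add_le[OF f e gs])
      also have "\<dots> \<le> 2 * ennreal s + 2 * ennreal (2 * B * L2norm_sq ?e)"
        unfolding s by (intro add_mono mult_left_mono up' e) auto
      also have "\<dots> = ennreal (2 * s + 4 * B * L2norm_sq ?e)"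
      proof -
        have "ennreal (2 * s + 2 * (2 * B * L2norm_sq ?e)) = 2 * ennreal s + 2 * ennreal (2 * B * L2norm_sq ?e)"
          using s B by (subst ennreal_plus; simp only: ennreal_mult' ennreal_numeral zero_le_mult_iff; simp)
        then show ?thesis by (simp add: mult.assoc)
      qed
      finally have "A * L2norm_sq (d n) \<le> 2 * s + 4 * B * L2norm_sq ?e"
        using s B by (subst (asm) ennreal_le_iff) auto
      moreover have "A * L2norm_sq f \<le> A * (2 * L2norm_sq (d n) + 2 * L2norm_sq (\<lambda>x. f x - d n x))"
        using A by (intro mult_left_mono L2norm_sq_le_approx f d) auto
      ultimately show ?thesis
        by (simp add: L2norm_sq_diff_commute[of f] algebra_simps)
    qed
    have "(\<lambda>n. 4 * s + (8 * B + 2 * A) * L2norm_sq (\<lambda>x. f x - d n x)) \<longlonglongrightarrow> 4 * s + (8 * B + 2 * A) * 0"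
      by (intro tendsto_add tendsto_mult tendsto_const lim)
    then have "A * L2norm_sq f \<le> 4 * s + (8 * B + 2 * A) * 0"
      by (rule LIMSEQ_le_const) (use bd in blast)
    then show ?thesis unfolding s by (intro ennreal_leI) simp
  qed
  show "frame gs"
    unfolding frame_eq_frame_on frame_on_def
    by (rule exI[of _ "A/4"], rule exI[of _ "2 * B"]) (use A B lo' up' in auto)
qed

section \<open>Approximation by continuous functions\<close>

text \<open>\<open>measurable_on\<close> is by definition an almost everywhere limit of continuous
  functions, so Lebesgue measurability already contains the claim. The convergence is only
  pointwise; norm convergence comes from truncation below.\<close>

lemma borel_measurable_AE_limit_continuous:
  fixes f :: "real \<Rightarrow> complex"
  assumes "f \<in> borel_measurable borel"
  obtains g where "\<And>n. continuous_on UNIV (g n)" "AE x in lborel. (\<lambda>n::nat. g n x) \<longlonglongrightarrow> f x"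
proof -
  have "f \<in> borel_measurable lebesgue"
    by (rule measurable_completion) (simp add: assms)
  then have "f measurable_on UNIV"
    by (rule lebesgue_measurable_imp_measurable_on) simp
  then obtain N g where N: "negligible N" and g: "\<And>n. continuous_on UNIV (g n)"
    and lim: "\<And>x. x \<notin> N \<Longrightarrow> (\<lambda>n. g n x) \<longlonglongrightarrow> f x"
    unfolding measurable_on_def by auto
  have "AE x in lebesgue. x \<notin> N"
    using N by (auto simp: negligible_iff_null_sets intro: AE_not_in)
  then have "AE x in lborel. x \<notin> N" by (simp add: AE_completion_iff)
  then have "AE x in lborel. (\<lambda>n. g n x) \<longlonglongrightarrow> f x"
    by eventually_elim (rule lim)
  with g show ?thesis by (rule that)
qed

text \<open>Radial projection onto the closed disc of radius \<open>M\<close>. Dividing by the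
  maximum gives one continuous formula, without a case split at the circle.\<close>

definition clamp_norm :: "real \<Rightarrow> complex \<Rightarrow> complex" where
  "clamp_norm M z = complex_of_real (M / max M (norm z)) * z"

lemma clamp_norm_le:
  assumes "M > 0"
  shows "norm (clamp_norm M z) \<le> M" "norm (clamp_norm M z) \<le> norm z"
proof -
  have "0 \<le> M / max M (norm z)" "M / max M (norm z) \<le> 1" using assms by (auto simp: divide_simps)
  then show "norm (clamp_norm M z) \<le> norm z"
    unfolding clamp_norm_def norm_mult norm_of_real by (intro mult_left_le_one_le) auto
  show "norm (clamp_norm M z) \<le> M"
    using assms by (auto simp: clamp_norm_def norm_mult norm_divide max_def)
qed

lemma continuous_on_clamp_norm: "M > 0 \<Longrightarrow> continuous_on UNIV (clamp_norm M)"
  unfolding clamp_norm_def by (intro continuous_intros) auto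

lemma clamp_norm_eq: "M > 0 \<Longrightarrow> norm z \<le> M \<Longrightarrow> clamp_norm M z = z"
  by (simp add: clamp_norm_def max_def)

text \<open>A product of two clipped ramps of slope \<open>r\<close>, continuous, which tends to the
  indicator of the open interval from A to B as \<open>r\<close> grows.\<close>

definition cutoff :: "real \<Rightarrow> real \<Rightarrow> real \<Rightarrow> real \<Rightarrow> real" where
  "cutoff A B r x = max 0 (min 1 (r * (x - A))) * max 0 (min 1 (r * (B - x)))"

lemma cutoff_bounds: "0 \<le> cutoff A B r x" "cutoff A B r x \<le> 1"
  unfolding cutoff_def by (auto intro!: mult_le_one)

lemma cutoff_outside: "r \<ge> 0 \<Longrightarrow> x \<notin> {A<..<B} \<Longrightarrow> cutoff A B r x = 0"
proof -
  assume r: "r \<ge> 0" and "x \<notin> {A<..<B}"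
  then have "r * (x - A) \<le> 0 \<or> r * (B - x) \<le> 0"
    by (auto simp: mult_le_0_iff not_less)
  then show ?thesis by (auto simp: cutoff_def)
qed

lemma continuous_on_cutoff: "continuous_on UNIV (cutoff A B r)"
  unfolding cutoff_def by (intro continuous_intros)

lemma cutoff_tendsto:
  assumes "A < x" "x < B"
  shows "(\<lambda>n. cutoff A B (real (Suc n)) x) \<longlonglongrightarrow> 1"
proof -
  have ev: "eventually (\<lambda>n. real (Suc n) * c \<ge> 1) sequentially" if "c > 0" for c :: real
  proof -
    obtain N :: nat where N: "1 / c \<le> real N" using real_arch_simple by blast
    show ?thesis using eventually_ge_at_top[of N]
    proof eventually_elim
      case (elim n)
      then have "1 / c \<le> real (Suc n)" using N by linarith
      then show ?case using that by (simp only: pos_divide_le_eq)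
    qed
  qed
  have "eventually (\<lambda>n. cutoff A B (real (Suc n)) x = 1) sequentially"
    using ev[of "x - A", simplified, OF assms(1)] ev[of "B - x", simplified, OF assms(2)]
    by eventually_elim (simp add: cutoff_def)
  then show ?thesis by (rule tendsto_eventually)
qed

text \<open>Pointwise limits give no control of norms, so the bounded, compactly supported
  truncation \<open>T n\<close> is applied to \<open>f\<close> and to its approximants alike.
  Dominated convergence is then used twice: \<open>T n f\<close> tends to \<open>f\<close> with
  majorant 4 |f|^2, and for one fixed \<open>n\<close> the functions \<open>T n (g j)\<close> tend
  to \<open>T n f\<close> with a constant majorant on [A, B].\<close>

lemma L2_approx_continuous:
  assumes f: "L2 f" and zero: "\<And>x. x \<notin> {A<..<B} \<Longrightarrow> f x = 0" and e: "e > 0"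
  obtains k where "continuous_on UNIV k" "\<And>x. x \<notin> {A<..<B} \<Longrightarrow> k x = 0" "L2 k"
    "L2norm_sq (\<lambda>x. f x - k x) < e"
proof -
  note [measurable] = L2_measurable[OF f]
  obtain g where g: "\<And>n. continuous_on UNIV (g n)" and lim: "AE x in lborel. (\<lambda>n::nat. g n x) \<longlonglongrightarrow> f x"
    using borel_measurable_AE_limit_continuous[of f] by auto
  have [measurable]: "g n \<in> borel_measurable borel" for n
    by (rule borel_measurable_continuous_onI[OF g])
  have cl[measurable]: "clamp_norm (real (Suc n)) \<in> borel_measurable borel" for n
    by (rule borel_measurable_continuous_onI[OF continuous_on_clamp_norm]) simp
  have [measurable]: "cutoff A B r \<in> borel_measurable borel" for r
    by (rule borel_measurable_continuous_onI[OF continuous_on_cutoff])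
  define T where "T n h x = complex_of_real (cutoff A B (real (Suc n)) x) * clamp_norm (real (Suc n)) (h x)"
    for n and h :: "real \<Rightarrow> complex" and x
  have T_le: "norm (T n h x) \<le> norm (h x)" "norm (T n h x) \<le> real (Suc n)" for n h x
  proof -
    have "norm (T n h x) \<le> norm (clamp_norm (real (Suc n)) (h x))"
      unfolding T_def norm_mult norm_of_real
      using cutoff_bounds[of A B "real (Suc n)" x] by (intro mult_left_le_one_le) auto
    note * = this
    show "norm (T n h x) \<le> norm (h x)"
      by (rule order_trans[OF * clamp_norm_le(2)]) simp
    show "norm (T n h x) \<le> real (Suc n)"
      by (rule order_trans[OF * clamp_norm_le(1)]) simp
  qed
  have T_out: "T n h x = 0" if "x \<notin> {A<..<B}" for n h x
    using that by (simp add: T_def cutoff_outside del: of_nat_Suc)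
  have T_meas[measurable]: "T n h \<in> borel_measurable borel" if [measurable]: "h \<in> borel_measurable borel" for n h
    unfolding T_def by measurable
  have "(\<lambda>n. L2norm_sq (\<lambda>x. f x - T n f x)) \<longlonglongrightarrow> 0"
  proof (rule L2_tendsto_zero[where h="\<lambda>x. 4 * (norm (f x))\<^sup>2"])
    show "integrable lborel (\<lambda>x. 4 * (norm (f x))\<^sup>2)" using L2_integrable[OF f] by simp
    show "(norm (f x - T n f x))\<^sup>2 \<le> 4 * (norm (f x))\<^sup>2" for n x
      using norm_diff_sq_le[of "f x" "T n f x"] power_mono[OF T_le(1)[of n f x] norm_ge_zero, of 2] by linarith
    have "(\<lambda>n. f x - T n f x) \<longlonglongrightarrow> 0" for x
    proof (cases "x \<in> {A<..<B}")
      case True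
      obtain N :: nat where N: "norm (f x) \<le> real N" using real_arch_simple by blast
      have "eventually (\<lambda>n. clamp_norm (real (Suc n)) (f x) = f x) sequentially"
        using eventually_ge_at_top[of N]
        by eventually_elim (rule clamp_norm_eq, use N in auto)
      then have "(\<lambda>n. clamp_norm (real (Suc n)) (f x)) \<longlonglongrightarrow> f x" by (rule tendsto_eventually)
      then have "(\<lambda>n. f x - T n f x) \<longlonglongrightarrow> f x - complex_of_real 1 * f x"
        unfolding T_def using True by (intro tendsto_intros cutoff_tendsto) auto
      then show ?thesis by simp
    qed (simp add: T_out zero)
    then show "AE x in lborel. (\<lambda>n. f x - T n f x) \<longlonglongrightarrow> 0" by simp
  qed measurable
  then have "eventually (\<lambda>n. L2norm_sq (\<lambda>x. f x - T n f x) < e / 4) sequentially"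
    using e by (intro order_tendstoD(2)) auto
  then obtain n where n: "L2norm_sq (\<lambda>x. f x - T n f x) < e / 4"
    by (auto simp: eventually_sequentially)
  have bound: "(norm (T n h x))\<^sup>2 \<le> (real (Suc n))\<^sup>2 * indicator {A..B} x" for h x
    using T_out[of x n h] power_mono[OF T_le(2)[of n h x] norm_ge_zero, of 2]
    by (cases "x \<in> {A<..<B}") (auto simp: indicator_def simp del: of_nat_Suc)
  have ib: "integrable lborel (\<lambda>x. c * indicator {A..B} x)" for c :: real
    by (intro integrable_mult_right integrable_real_indicator) (auto simp: emeasure_lborel_Icc_eq)
  have T_L2: "L2 (T n h)" if "h \<in> borel_measurable borel" for h
    by (rule L2_bound[OF T_meas[OF that] ib bound])
  have "(\<lambda>j. L2norm_sq (\<lambda>x. T n f x - T n (g j) x)) \<longlonglongrightarrow> 0"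
  proof (rule L2_tendsto_zero[where h="\<lambda>x. (4 * (real (Suc n))\<^sup>2) * indicator {A..B} x"])
    show "(norm (T n f x - T n (g j) x))\<^sup>2 \<le> 4 * (real (Suc n))\<^sup>2 * indicator {A..B} x" for j x
      using norm_diff_sq_le[of "T n f x" "T n (g j) x"] bound[of f x] bound[of "g j" x] by linarith
    show "AE x in lborel. (\<lambda>j. T n f x - T n (g j) x) \<longlonglongrightarrow> 0"
      using lim
    proof eventually_elim
      case (elim x)
      have "isCont (clamp_norm (real (Suc n))) (f x)"
        using continuous_on_clamp_norm[of "real (Suc n)"] by (simp add: continuous_on_eq_continuous_at)
      from isCont_tendsto_compose[OF this elim]
      have "(\<lambda>j. T n f x - T n (g j) x) \<longlonglongrightarrow> T n f x - T n f x"
        unfolding T_def by (intro tendsto_intros)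
      then show ?case by simp
    qed
  qed (use ib in measurable)
  then have "eventually (\<lambda>j. L2norm_sq (\<lambda>x. T n f x - T n (g j) x) < e / 4) sequentially"
    using e by (intro order_tendstoD(2)) auto
  then obtain j where j: "L2norm_sq (\<lambda>x. T n f x - T n (g j) x) < e / 4"
    by (auto simp: eventually_sequentially)
  have L: "L2 (T n f)" "L2 (T n (g j))" by (rule T_L2, measurable)+
  have "L2norm_sq (\<lambda>x. f x - T n (g j) x) \<le>
      2 * L2norm_sq (\<lambda>x. f x - T n f x) + 2 * L2norm_sq (\<lambda>x. T n f x - T n (g j) x)"
    using L2_add(2)[OF L2_diff(1)[OF f L(1)] L2_diff(1)[OF L]] by simp
  with n j have "L2norm_sq (\<lambda>x. f x - T n (g j) x) < e" by linarith
  moreover have "continuous_on UNIV (T n (g j))"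
    unfolding T_def
    by (intro continuous_intros continuous_on_cutoff g
        continuous_on_compose2[OF continuous_on_clamp_norm g]) auto
  ultimately show ?thesis using that T_out L(2) by blast
qed

section \<open>Trigonometric polynomials\<close>

definition trig_poly :: "(real \<Rightarrow> complex) \<Rightarrow> bool" where
  "trig_poly h \<longleftrightarrow> (\<exists>J c. finite J \<and> (\<forall>x. h x = (\<Sum>n\<in>J. c n * cis (real_of_int n * x))))"

lemma trig_poly_monomial: "trig_poly (\<lambda>x. c * cis (real_of_int n * x))"
  unfolding trig_poly_def by (rule exI[of _ "{n}"], rule exI[of _ "\<lambda>_. c"]) simp

lemma trig_poly_add:
  assumes "trig_poly h" "trig_poly k"
  shows "trig_poly (\<lambda>x. h x + k x)"
proof -
  obtain J c where J: "finite J" "\<And>x. h x = (\<Sum>n\<in>J. c n * cis (real_of_int n * x))"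
    using assms(1) unfolding trig_poly_def by blast
  obtain K d where K: "finite K" "\<And>x. k x = (\<Sum>n\<in>K. d n * cis (real_of_int n * x))"
    using assms(2) unfolding trig_poly_def by blast
  let ?c = "\<lambda>n. (if n \<in> J then c n else 0) + (if n \<in> K then d n else 0)"
  have "h x + k x = (\<Sum>n\<in>J \<union> K. ?c n * cis (real_of_int n * x))" for x
  proof -
    have "h x = (\<Sum>n\<in>J \<union> K. (if n \<in> J then c n else 0) * cis (real_of_int n * x))"
      unfolding J(2) by (rule sum.mono_neutral_cong_left) (use J K in auto)
    moreover have "k x = (\<Sum>n\<in>J \<union> K. (if n \<in> K then d n else 0) * cis (real_of_int n * x))"
      unfolding K(2) by (rule sum.mono_neutral_cong_left) (use J K in auto)
    ultimately show ?thesis by (simp add: sum.distrib distrib_right)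
  qed
  then show ?thesis unfolding trig_poly_def
    by (intro exI[of _ "J \<union> K"] exI[of _ ?c] conjI allI) (use J(1) K(1) in simp_all)
qed

lemma trig_poly_const: "trig_poly (\<lambda>x. c)"
  using trig_poly_monomial[of c 0] by simp

lemma trig_poly_sum: "finite I \<Longrightarrow> (\<And>i. i \<in> I \<Longrightarrow> trig_poly (h i)) \<Longrightarrow> trig_poly (\<lambda>x. \<Sum>i\<in>I. h i x)"
  by (induction I rule: finite_induct) (auto intro: trig_poly_add trig_poly_const)

lemma trig_poly_mult:
  assumes "trig_poly h" "trig_poly k"
  shows "trig_poly (\<lambda>x. h x * k x)"
proof -
  obtain J c where J: "finite J" "\<And>x. h x = (\<Sum>n\<in>J. c n * cis (real_of_int n * x))"
    using assms(1) unfolding trig_poly_def by blast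
  obtain K d where K: "finite K" "\<And>x. k x = (\<Sum>n\<in>K. d n * cis (real_of_int n * x))"
    using assms(2) unfolding trig_poly_def by blast
  have "(\<lambda>x. h x * k x) = (\<lambda>x. \<Sum>n\<in>J. \<Sum>m\<in>K. (c n * d m) * cis (real_of_int (n + m) * x))"
  proof (rule ext)
    fix x
    have "cis (real_of_int (n + m) * x) = cis (real_of_int n * x) * cis (real_of_int m * x)" for n m
      by (simp add: cis_mult distrib_right)
    then show "h x * k x = (\<Sum>n\<in>J. \<Sum>m\<in>K. (c n * d m) * cis (real_of_int (n + m) * x))"
      by (simp add: J(2) K(2) sum_product mult_ac)
  qed
  then show ?thesis
    using J(1) K(1) by (simp only:) (intro trig_poly_sum trig_poly_monomial)
qed

text \<open>Real polynomial functions on the complex plane are polynomials in Re z and Im z, so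
  conjugates are included. A real-linear functional restricted to the circle is a combination of cos
  x and sin x, hence of the frequencies 1 and -1.\<close>

lemma trig_poly_real_polynomial:
  assumes "real_polynomial_function p"
  shows "trig_poly (\<lambda>x. complex_of_real (p (cis x)))"
  using assms
proof (induction rule: real_polynomial_function.induct)
  case (linear f)
  interpret bounded_linear f by fact
  have "f (cis x) = f (Re (cis x) *\<^sub>R 1 + Im (cis x) *\<^sub>R \<i>)" for x
    by (rule arg_cong[of _ _ f]) (simp add: complex_eq_iff)
  then have "f (cis x) = cos x * f 1 + sin x * f \<i>" for x
    by (simp add: add scaleR)
  moreover have "complex_of_real (cos x) = 1/2 * cis (real_of_int 1 * x) + 1/2 * cis (real_of_int (-1) * x)"
    "complex_of_real (sin x) = - \<i>/2 * cis (real_of_int 1 * x) + \<i>/2 * cis (real_of_int (-1) * x)" for x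
    by (auto simp: complex_eq_iff)
  ultimately have *: "(\<lambda>x. complex_of_real (f (cis x))) =
     (\<lambda>x. (1/2 * cis (real_of_int 1 * x) + 1/2 * cis (real_of_int (-1) * x)) * complex_of_real (f 1) +
       (- \<i>/2 * cis (real_of_int 1 * x) + \<i>/2 * cis (real_of_int (-1) * x)) * complex_of_real (f \<i>))"
    by (simp only: of_real_add of_real_mult)
  show ?case unfolding * by (intro trig_poly_add trig_poly_mult trig_poly_monomial trig_poly_const)
qed (auto intro: trig_poly_add trig_poly_mult trig_poly_const)

lemma trig_poly_polynomial:
  fixes p :: "complex \<Rightarrow> complex"
  assumes "polynomial_function p"
  shows "trig_poly (\<lambda>x. p (cis x))"
proof -
  have "real_polynomial_function (\<lambda>z. Re (p z))" "real_polynomial_function (\<lambda>z. Im (p z))"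
    using assms bounded_linear_Re bounded_linear_Im by (auto simp: polynomial_function_def o_def)
  then have "trig_poly (\<lambda>x. complex_of_real (Re (p (cis x))) + \<i> * complex_of_real (Im (p (cis x))))"
    by (intro trig_poly_add trig_poly_mult trig_poly_const trig_poly_real_polynomial)
  then show ?thesis by (simp only: complex_eq[symmetric])
qed

text \<open>Equal end values let \<open>k\<close> descend to a continuous function \<open>kt\<close>
  on the unit circle, where Stone-Weierstrass applies. The bound \<open>K + e\<close> holds on the
  whole line; it later allows a Gaussian to dominate the error outside [A, B], where nothing is
  approximated.\<close>

lemma trig_poly_approx:
  fixes k :: "real \<Rightarrow> complex"
  assumes AB: "A < B" and k: "continuous_on {A..B} k" "k A = k B" and e: "e > 0"
    and K: "\<And>x. x \<in> {A..B} \<Longrightarrow> norm (k x) \<le> K"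
  obtains p where "trig_poly p" "\<And>x. norm (p x) \<le> K + e"
    "\<And>x. x \<in> {A..B} \<Longrightarrow> norm (k x - p (2 * pi * x / (B - A))) < e"
proof -
  define s where "s x = cis (2 * pi * x / (B - A))" for x
  \<comment> \<open>The curve \<open>s\<close> goes once around the circle, so only the two end
    points are identified: |x - y| <= B - A leaves n in {-1, 0, 1}.\<close>
  have s_eq: "k x = k y" if xy: "x \<in> {A..B}" "y \<in> {A..B}" "s x = s y" for x y
  proof -
    have "sin (2 * pi * x / (B - A)) = sin (2 * pi * y / (B - A)) \<and> cos (2 * pi * x / (B - A)) = cos (2 * pi * y / (B - A))"
      using xy(3) unfolding s_def by (simp add: complex_eq_iff)
    then obtain n :: int where "2 * pi * x / (B - A) = 2 * pi * y / (B - A) + 2 * pi * real_of_int n"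
      unfolding sin_cos_eq_iff by blast
    then have "2 * pi * ((x - y) / (B - A)) = 2 * pi * real_of_int n"
      by (simp add: diff_divide_distrib right_diff_distrib)
    then have "(x - y) / (B - A) = real_of_int n"
      by (rule mult_left_cancel[THEN iffD1, rotated]) simp
    then have n: "x - y = real_of_int n * (B - A)"
      using AB by (simp add: field_simps)
    have "\<bar>x - y\<bar> \<le> B - A" using xy by auto
    then have "\<bar>real_of_int n\<bar> \<le> 1" using AB unfolding n by (simp add: abs_mult)
    then have "n = 0 \<or> n = 1 \<or> n = -1" by linarith
    then consider "n = 0" | "n = 1" | "n = -1" by blast
    then show ?thesis
    proof cases
      case 2 then have "x = B" "y = A" using n xy AB by simp_all then show ?thesis using k(2) by simp
    next
      case 3 then have "x = A" "y = B" using n xy AB by simp_all then show ?thesis using k(2) by simp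
    qed (use n in auto)
  qed
  define S where "S = s ` {A..B}"
  define kt where "kt z = k (inv_into {A..B} s z)" for z
  have kt: "kt (s x) = k x" if "x \<in> {A..B}" for x
  proof -
    have "s x \<in> s ` {A..B}" using that by (rule imageI)
    then have "inv_into {A..B} s (s x) \<in> {A..B}" "s (inv_into {A..B} s (s x)) = s x"
      by (rule inv_into_into, rule f_inv_into_f)
    then show ?thesis unfolding kt_def using that by (intro s_eq)
  qed
  have s_cont: "continuous_on {A..B} s" 
    using AB unfolding s_def by (auto intro!: continuous_intros)
  have S: "compact S" unfolding S_def by (intro compact_continuous_image s_cont) simp
  \<comment> \<open>The preimage of a closed set under \<open>kt\<close> is the image under
    \<open>s\<close> of a compact set, hence closed: \<open>s\<close> is a quotient map from a
    compact interval.\<close>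
  have "continuous_on S kt"
    unfolding continuous_on_closed_vimage[OF compact_imp_closed[OF S]]
  proof (intro allI impI)
    fix C :: "complex set" assume C: "closed C"
    have "kt -` C \<inter> S = s ` ({A..B} \<inter> k -` C)"
    proof (intro equalityI subsetI)
      fix z assume "z \<in> kt -` C \<inter> S"
      then obtain x where "x \<in> {A..B}" "z = s x" "kt (s x) \<in> C" unfolding S_def by auto
      then show "z \<in> s ` ({A..B} \<inter> k -` C)" using kt by simp
    next
      fix z assume "z \<in> s ` ({A..B} \<inter> k -` C)"
      then obtain x where "x \<in> {A..B}" "z = s x" "k x \<in> C" by auto
      then show "z \<in> kt -` C \<inter> S" using kt by (simp add: S_def)
    qed
    moreover have "compact ({A..B} \<inter> k -` C)"
      using continuous_closed_preimage[OF k(1) _ C] by (simp add: compact_eq_bounded_closed bounded_subset[OF bounded_closed_interval[of A B]])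
    ultimately show "closed (kt -` C \<inter> S)"
      by (auto intro!: compact_imp_closed compact_continuous_image continuous_on_subset[OF s_cont])
  qed
  from Stone_Weierstrass_polynomial_function[OF S this e]
  obtain p where p: "polynomial_function p" "\<And>z. z \<in> S \<Longrightarrow> norm (kt z - p z) < e" by blast
  \<comment> \<open>Removing whole periods B - A leads to a point of [A, B]. So \<open>S\<close> is
    the full circle, and an estimate on \<open>S\<close> bounds \<open>p\<close> at every
    \<open>cis t\<close>.\<close>
  have surj: "cis t \<in> S" for t
  proof -
    define x where "x = t * (B - A) / (2 * pi)"
    define n where "n = \<lfloor>(x - A) / (B - A)\<rfloor>"
    have "real_of_int n \<le> (x - A) / (B - A)" "(x - A) / (B - A) < real_of_int n + 1"
      unfolding n_def by linarith+
    then have "x - real_of_int n * (B - A) \<in> {A..B}" using AB by (auto simp: field_simps)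
    moreover have "s (x - real_of_int n * (B - A)) = cis t"
    proof -
      have "2 * pi * (x - real_of_int n * (B - A)) / (B - A) = t - 2 * pi * real_of_int n"
        using AB by (simp add: x_def field_simps)
      moreover have "cis (2 * pi * real_of_int n) = 1" by (rule cis_multiple_2pi) simp
      ultimately show ?thesis by (simp only: s_def cis_divide[symmetric] div_by_1)
    qed
    ultimately show ?thesis unfolding S_def by (metis image_eqI)
  qed
  show ?thesis
  proof
    show "trig_poly (\<lambda>x. p (cis x))" using p(1) by (rule trig_poly_polynomial)
    show "norm (p (cis t)) \<le> K + e" for t
    proof -
      obtain x where x: "x \<in> {A..B}" "cis t = s x" using surj[of t] unfolding S_def by blast
      have "norm (p (s x)) \<le> norm (k x) + norm (kt (s x) - p (s x))"
        unfolding kt[OF x(1)] by (metis norm_minus_commute norm_triangle_sub[of "p (s x)" "k x"])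
      also have "\<dots> \<le> K + e" using K[OF x(1)] p(2)[of "s x"] imageI[OF x(1), of s] unfolding S_def by linarith
      finally show ?thesis by (simp add: x)
    qed
    show "norm (k x - p (cis (2 * pi * x / (B - A)))) < e" if "x \<in> {A..B}" for x
      using p(2)[of "s x"] that kt[OF that] by (auto simp: S_def s_def)
  qed
qed

section \<open>Fourier series on an interval\<close>

text \<open>Fatou's lemma along the symmetric truncations; it reduces Bessel's inequality to finite
  sums.\<close>

lemma nn_integral_count_space_int_le:
  fixes f :: "int \<Rightarrow> ennreal"
  assumes "\<And>N::nat. (\<Sum>n\<in>{- int N..int N}. f n) \<le> C"
  shows "(\<integral>\<^sup>+ n. f n \<partial>count_space UNIV) \<le> C"
proof -
  let ?g = "\<lambda>N n. f n * indicator {- int N..int N} n"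
  have "f n = liminf (\<lambda>N. ?g N n)" for n
  proof -
    have "eventually (\<lambda>N. ?g N n = f n) sequentially"
      using eventually_ge_at_top[of "nat \<bar>n\<bar>"] by eventually_elim (auto simp: indicator_def)
    then have "(\<lambda>N. ?g N n) \<longlonglongrightarrow> f n" by (rule tendsto_eventually)
    then show ?thesis by (rule lim_imp_Liminf[symmetric, rotated]) simp
  qed
  then have "(\<integral>\<^sup>+ n. f n \<partial>count_space UNIV) = (\<integral>\<^sup>+ n. liminf (\<lambda>N. ?g N n) \<partial>count_space UNIV)" by simp
  also have "\<dots> \<le> liminf (\<lambda>N. \<integral>\<^sup>+ n. ?g N n \<partial>count_space UNIV)"
    by (rule nn_integral_liminf) simp
  also have "(\<lambda>N. \<integral>\<^sup>+ n. ?g N n \<partial>count_space UNIV) = (\<lambda>N. \<Sum>n\<in>{- int N..int N}. f n)"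
  proof (rule ext)
    fix N :: nat
    show "(\<integral>\<^sup>+ n. ?g N n \<partial>count_space UNIV) = (\<Sum>n\<in>{- int N..int N}. f n)"
      by (subst nn_integral_count_space'[where A="{- int N..int N}"]) auto
  qed
  also have "liminf \<dots> \<le> liminf (\<lambda>N. C)"
    by (intro Liminf_mono always_eventually allI assms)
  finally show ?thesis by (simp add: Liminf_const)
qed

text \<open>Not normalised: the squared norm is \<open>u\<close>, which is the factor in
  \<open>Fourier_Parseval\<close>. Cutting to [0, u] makes Fourier coefficients inner products over
  the whole line.\<close>

definition fourier_exp :: "real \<Rightarrow> int \<Rightarrow> real \<Rightarrow> complex" where
  "fourier_exp u n x = indicator {0..u} x *\<^sub>R cis (2 * pi * real_of_int n * x / u)"

lemma measurable_cis [measurable]: "cis \<in> borel_measurable borel"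
  by (intro borel_measurable_continuous_onI continuous_intros)

lemma fourier_exp_measurable [measurable]: "fourier_exp u n \<in> borel_measurable borel"
  unfolding fourier_exp_def by measurable

lemma L2_indicator_bounded:
  assumes "h \<in> borel_measurable borel" "\<And>x. norm (h x) \<le> c" "\<And>x. x \<notin> {0..u} \<Longrightarrow> h x = 0" "u \<ge> 0"
  shows "L2 h" "L2norm_sq h \<le> c\<^sup>2 * u"
proof -
  have b: "(norm (h x))\<^sup>2 \<le> c\<^sup>2 * indicator {0..u} x" for x
    using assms(2)[of x] assms(3)[of x] by (cases "x \<in> {0..u}") (auto intro: power_mono)
  have i: "integrable lborel (\<lambda>x. c\<^sup>2 * indicator {0..u} x :: real)"
    by (intro integrable_mult_right integrable_real_indicator) (auto simp: emeasure_lborel_Icc_eq)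
  note B = L2_bound[OF assms(1) i b]
  show "L2 h" by (rule B(1))
  show "L2norm_sq h \<le> c\<^sup>2 * u" using B(2) assms(4) by simp
qed

lemma L2_fourier_exp: "u > 0 \<Longrightarrow> L2 (fourier_exp u n)"
  by (rule L2_indicator_bounded[where c=1 and u=u]) (auto simp: fourier_exp_def indicator_def)

lemma fourier_exp_orthogonal:
  assumes u: "u > 0"
  shows "L2inner (fourier_exp u n) (fourier_exp u m) = (if n = m then complex_of_real u else 0)"
proof -
  have eq: "fourier_exp u n x * cnj (fourier_exp u m x) =
      indicator {0..u} x *\<^sub>R cis (2 * pi * real_of_int (n - m) / u * x)" for x
    by (auto simp: fourier_exp_def indicator_def cis_cnj cis_mult diff_divide_distrib algebra_simps)
  show ?thesis
  proof (cases "n = m")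
    case True
    have "L2inner (fourier_exp u n) (fourier_exp u m) = (LINT x|lborel. indicator {0..u} x *\<^sub>R (1::complex))"
      unfolding L2inner_def eq using True by simp
    then show ?thesis using True u by (simp add: scaleR_conv_of_real)
  next
    case False
    define c where "c = 2 * pi * real_of_int (n - m) / u"
    have c: "c \<noteq> 0" using False u by (simp add: c_def)
    have "(LINT x|lborel. indicator {0..u} x *\<^sub>R cis (c * x)) =
        cis (c * u) / (\<i> * c) - cis (c * 0) / (\<i> * c)"
    proof (rule integral_FTC_Icc)
      show "continuous_on {0..u} (\<lambda>x. cis (c * x))" by (intro continuous_intros)
      show "((\<lambda>x. cis (c * x) / (\<i> * c)) has_vector_derivative cis (c * x)) (at x within {0..u})" for x
      proof -
        have "((\<lambda>z. exp (\<i> * complex_of_real c * z) / (\<i> * c)) has_field_derivative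
            exp (\<i> * complex_of_real c * complex_of_real x)) (at (complex_of_real x))"
          using c by (auto intro!: derivative_eq_intros)
        from has_vector_derivative_real_field[OF this] show ?thesis
          by (simp add: cis_conv_exp mult.assoc)
      qed
    qed (use u in simp)
    moreover have "cis (c * u) = 1"
    proof -
      have "c * u = 2 * pi * real_of_int (n - m)" using u by (simp add: c_def)
      then show ?thesis by (simp only: cis_multiple_2pi Ints_of_int)
    qed
    ultimately show ?thesis using False by (simp add: L2inner_def eq c_def)
  qed
qed

text \<open>Completing the square around the best coefficients
  \<open>L2inner f (fourier_exp u n) / u\<close>. Choosing \<open>d\<close> equal to them gives
  Bessel's inequality; for any other \<open>d\<close> the last term is nonnegative, so a good
  approximant forces the coefficient sum to be large. Both halves of Parseval are read off
  here.\<close>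

lemma L2norm_sq_diff_fourier_sum:
  assumes u: "u > 0" and f: "L2 f" and J: "finite J"
  shows "L2norm_sq (\<lambda>x. f x - (\<Sum>n\<in>J. d n * fourier_exp u n x)) =
    L2norm_sq f - (\<Sum>n\<in>J. (norm (L2inner f (fourier_exp u n)))\<^sup>2) / u
      + u * (\<Sum>n\<in>J. (norm (d n - L2inner f (fourier_exp u n) / u))\<^sup>2)"
proof -
  let ?c = "\<lambda>n. L2inner f (fourier_exp u n)"
  let ?q = "\<lambda>x. \<Sum>n\<in>J. d n * fourier_exp u n x"
  have e: "L2 (\<lambda>x. d n * fourier_exp u n x)" for n by (intro L2_cmult L2_fourier_exp u)
  have q: "L2 ?q" by (intro L2_sum J e)
  have in_q: "L2inner h ?q = (\<Sum>n\<in>J. cnj (d n) * L2inner h (fourier_exp u n))" if h: "L2 h" for h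
  proof -
    have "cnj (L2inner ?q h) = cnj (\<Sum>n\<in>J. d n * L2inner (fourier_exp u n) h)"
      by (subst L2inner_sum_left[OF J e h]) (simp add: L2inner_cmult_left)
    then show ?thesis by (simp add: L2inner_cnj)
  qed
  have "L2inner (fourier_exp u n) ?q = cnj (d n) * u" if "n \<in> J" for n
    using that J u by (simp add: in_q L2_fourier_exp fourier_exp_orthogonal if_distrib sum.delta cong: if_cong)
  then have "L2inner ?q ?q = (\<Sum>n\<in>J. complex_of_real (u * (norm (d n))\<^sup>2))"
    by (subst L2inner_sum_left[OF J e q]) (simp add: L2inner_cmult_left complex_norm_square mult_ac del: of_real_power)
  then have "complex_of_real (L2norm_sq ?q) = complex_of_real (\<Sum>n\<in>J. u * (norm (d n))\<^sup>2)"
    by (simp add: L2inner_self)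
  then have nq: "L2norm_sq ?q = (\<Sum>n\<in>J. u * (norm (d n))\<^sup>2)" by (simp only: of_real_eq_iff)
  have pt: "u * (norm (d n))\<^sup>2 - 2 * Re (cnj (d n) * ?c n) =
      u * (norm (d n - ?c n / u))\<^sup>2 - (norm (?c n))\<^sup>2 / u" for n
    unfolding cmod_power2 using u by (simp add: field_simps power2_eq_square)
  have "L2norm_sq (\<lambda>x. f x - ?q x) = L2norm_sq f + (\<Sum>n\<in>J. u * (norm (d n))\<^sup>2 - 2 * Re (cnj (d n) * ?c n))"
    unfolding L2norm_sq_diff[OF f q] nq in_q[OF f] Re_sum sum_subtractf sum_distrib_left by simp
  then show ?thesis
    unfolding pt sum_subtractf sum_distrib_left sum_divide_distrib by simp
qed

text \<open>Vanishing off the open interval makes the continuous approximant zero at both ends,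
  hence periodic, so that trigonometric polynomials approximate it uniformly.\<close>

theorem Fourier_Parseval:
  assumes u: "u > 0" and f: "L2 f" and zero: "\<And>x. x \<notin> {0<..<u} \<Longrightarrow> f x = 0"
  shows "frame_sum (fourier_exp u) f = ennreal (u * L2norm_sq f)"
proof (rule antisym)
  let ?c = "\<lambda>n. L2inner f (fourier_exp u n)"
  show "frame_sum (fourier_exp u) f \<le> ennreal (u * L2norm_sq f)"
    unfolding frame_sum_def
  proof (rule nn_integral_count_space_int_le)
    fix N :: nat
    let ?J = "{- int N..int N}"
    have "0 \<le> L2norm_sq f - (\<Sum>n\<in>?J. (norm (?c n))\<^sup>2) / u"
      using L2norm_sq_diff_fourier_sum[OF u f, of ?J "\<lambda>n. ?c n / u"]
        L2norm_sq_nonneg[of "\<lambda>x. f x - (\<Sum>n\<in>?J. ?c n / u * fourier_exp u n x)"] by simp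
    then have "(\<Sum>n\<in>?J. (norm (?c n))\<^sup>2) \<le> u * L2norm_sq f" using u by (simp add: field_simps)
    then show "(\<Sum>n\<in>?J. ennreal ((norm (?c n))\<^sup>2)) \<le> ennreal (u * L2norm_sq f)"
      by (subst sum_ennreal) (auto intro: ennreal_leI)
  qed
  show "ennreal (u * L2norm_sq f) \<le> frame_sum (fourier_exp u) f"
  proof (rule ennreal_le_epsilon)
    fix \<epsilon> :: real assume \<epsilon>: "0 < \<epsilon>"
    \<comment> \<open>Two errors of at most \<delta> give a squared distance of at most 4 \<delta>,
      which multiplied by \<open>u\<close> is \<epsilon>. Below, \<eta> is the uniform error that
      costs \<delta> on an interval of length \<open>u\<close>.\<close>
    define \<delta> where "\<delta> = \<epsilon> / (4 * u)"
    have \<delta>: "\<delta> > 0" using \<epsilon> u by (simp add: \<delta>_def)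
    obtain k where k: "continuous_on UNIV k" "\<And>x. x \<notin> {0<..<u} \<Longrightarrow> k x = 0" "L2 k"
      "L2norm_sq (\<lambda>x. f x - k x) < \<delta>"
      using L2_approx_continuous[OF f zero \<delta>] by blast
    have ck: "continuous_on {0..u} k" using k(1) by (rule continuous_on_subset) simp
    have "bounded (k ` {0..u})" by (intro compact_imp_bounded compact_continuous_image ck) simp
    then obtain K where K: "\<And>x. x \<in> {0..u} \<Longrightarrow> norm (k x) \<le> K"
      unfolding bounded_iff by (metis imageI)
    define \<eta> where "\<eta> = sqrt (\<delta> / u)"
    have \<eta>: "\<eta> > 0" "\<eta>\<^sup>2 * u = \<delta>" using \<delta> u by (auto simp: \<eta>_def)
    obtain p where p: "trig_poly p" "\<And>x. x \<in> {0..u} \<Longrightarrow> norm (k x - p (2 * pi * x / u)) < \<eta>"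
    proof -
      have "k 0 = k u" by (simp add: k(2))
      from trig_poly_approx[OF u ck this \<eta>(1) K] obtain p where "trig_poly p"
        "\<And>x. x \<in> {0..u} \<Longrightarrow> norm (k x - p (2 * pi * x / (u - 0))) < \<eta>" by metis
      then show ?thesis using that by simp
    qed
    obtain J d where J: "finite J" "\<And>x. p x = (\<Sum>n\<in>J. d n * cis (real_of_int n * x))"
      using p(1) unfolding trig_poly_def by auto
    let ?q = "\<lambda>x. \<Sum>n\<in>J. d n * fourier_exp u n x"
    have q: "L2 ?q" by (intro L2_sum J L2_cmult L2_fourier_exp u)
    have qp: "?q x = (if x \<in> {0..u} then p (2 * pi * x / u) else 0)" for x
      by (auto simp: J(2) fourier_exp_def mult_ac)
    note [measurable] = L2_measurable[OF k(3)] L2_measurable[OF q]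
    have "L2norm_sq (\<lambda>x. k x - ?q x) \<le> \<eta>\<^sup>2 * u"
    proof (rule L2_indicator_bounded(2))
      show "norm (k x - ?q x) \<le> \<eta>" for x
        using p(2)[of x] k(2)[of x] \<eta>(1) unfolding qp by (auto intro: less_imp_le)
      show "k x - ?q x = 0" if "x \<notin> {0..u}" for x
        using that k(2)[of x] unfolding qp by auto
    qed (use u in \<open>auto\<close>)
    then have "L2norm_sq (\<lambda>x. f x - ?q x) \<le> 4 * \<delta>"
      using L2_add(2)[OF L2_diff(1)[OF f k(3)] L2_diff(1)[OF k(3) q]] k(4) \<eta>(2) by simp
    moreover have "0 \<le> u * (\<Sum>n\<in>J. (norm (d n - ?c n / u))\<^sup>2)"
      using u by (intro mult_nonneg_nonneg sum_nonneg) auto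
    ultimately have "L2norm_sq f - (\<Sum>n\<in>J. (norm (?c n))\<^sup>2) / u \<le> 4 * \<delta>"
      using L2norm_sq_diff_fourier_sum[OF u f J(1), of d] by linarith
    from mult_left_mono[OF this, of u]
    have "u * L2norm_sq f \<le> (\<Sum>n\<in>J. (norm (?c n))\<^sup>2) + \<epsilon>"
      using u by (simp add: \<delta>_def right_diff_distrib)
    then have "ennreal (u * L2norm_sq f) \<le> ennreal ((\<Sum>n\<in>J. (norm (?c n))\<^sup>2) + \<epsilon>)" by (rule ennreal_leI)
    also have "\<dots> = (\<Sum>n\<in>J. ennreal ((norm (?c n))\<^sup>2)) + ennreal \<epsilon>"
      using \<epsilon> by (simp add: ennreal_plus sum_nonneg)
    also have "(\<Sum>n\<in>J. ennreal ((norm (?c n))\<^sup>2)) =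
        (\<integral>\<^sup>+ n. ennreal ((norm (?c n))\<^sup>2) * indicator J n \<partial>count_space UNIV)"
      using J(1) by (subst nn_integral_count_space'[where A=J]) auto
    also have "\<dots> \<le> frame_sum (fourier_exp u) f"
      unfolding frame_sum_def by (intro nn_integral_mono) (auto simp: indicator_def)
    finally show "ennreal (u * L2norm_sq f) \<le> frame_sum (fourier_exp u) f + ennreal \<epsilon>"
      by (simp add: add_right_mono)
  qed
qed

section \<open>Fourier pairs\<close>

text \<open>Both formulas hold at every point, so each function is bounded by the L^1 norm of the
  other and both are in L^2. The positive sign in the first kernel is the one for which an
  exponential on the half line x > 0 transforms into a multiple of 1/(t - iw) with w < 0.\<close>

definition fourier_pair :: "(real \<Rightarrow> complex) \<Rightarrow> (real \<Rightarrow> complex) \<Rightarrow> bool" where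
  "fourier_pair f \<phi> \<longleftrightarrow> integrable lborel f \<and> integrable lborel \<phi> \<and>
     (\<forall>t. \<phi> t = (LINT x|lborel. f x * cis (2 * pi * x * t))) \<and>
     (\<forall>x. f x = (LINT t|lborel. \<phi> t * cis (- (2 * pi * x * t))))"

lemma fourier_pairD:
  assumes "fourier_pair f \<phi>"
  shows "integrable lborel f" "integrable lborel \<phi>"
    "\<phi> t = (LINT x|lborel. f x * cis (2 * pi * x * t))"
    "f x = (LINT t|lborel. \<phi> t * cis (- (2 * pi * x * t)))"
  using assms unfolding fourier_pair_def by blast+

lemma integrable_mult_cis:
  assumes "integrable lborel f" "(\<lambda>x. h x) \<in> borel_measurable borel"
  shows "integrable lborel (\<lambda>x. f x * cis (h x))"
  by (rule Bochner_Integration.integrable_bound[OF assms(1)])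
     (use assms in \<open>auto simp: norm_mult\<close>)

lemma cnj_integral_cis:
  "cnj (LINT x|lborel. f x * cis (h x)) = (LINT x|lborel. cnj (f x) * cis (- h x))"
proof -
  have "cnj (LINT x|lborel. f x * cis (h x)) = (LINT x|lborel. cnj (f x * cis (h x)))"
    by (rule Bochner_Integration.integral_cnj[symmetric])
  then show ?thesis by (simp only: complex_cnj_mult cis_cnj)
qed

lemma L2_bounded_integrable:
  assumes f: "integrable lborel f" and b: "\<And>x. norm (f x) \<le> K"
  shows "L2 f"
proof (rule L2_bound(1))
  show "f \<in> borel_measurable borel" using f by auto
  show "integrable lborel (\<lambda>x. K * norm (f x))" using f by simp
  show "(norm (f x))\<^sup>2 \<le> K * norm (f x)" for x
    unfolding power2_eq_square by (intro mult_right_mono b) simp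
qed

lemma fourier_pair_L2:
  assumes "fourier_pair f \<phi>"
  shows "L2 f" "L2 \<phi>"
proof -
  have *: "norm (LINT x|lborel. h x * cis (r x)) \<le> (LINT x|lborel. norm (h x))" for h :: "real \<Rightarrow> complex" and r
    by (rule order_trans[OF integral_norm_bound]) (simp add: norm_mult)
  have int: "integrable lborel f" "integrable lborel \<phi>"
    and eq: "\<phi> t = (LINT x|lborel. f x * cis (2 * pi * x * t))"
      "f t = (LINT x|lborel. \<phi> x * cis (- (2 * pi * t * x)))" for t
    using assms unfolding fourier_pair_def by blast+
  show "L2 f"
    by (rule L2_bounded_integrable[OF int(1), of "LINT x|lborel. norm (\<phi> x)"]) (subst eq(2), rule *)
  show "L2 \<phi>"
    by (rule L2_bounded_integrable[OF int(2), of "LINT x|lborel. norm (f x)"]) (subst eq(1), rule *)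
qed

text \<open>Fubini for the function \<phi>(t) cnj(k(x)) times a unimodular kernel, which is
  integrable over the plane. Integrability is asked of \<open>k\<close> and not of \<open>K\<close>,
  because \<open>K\<close> will be a Gabor function, which may decay only like 1/|t|.\<close>

lemma fourier_pair_Parseval:
  assumes fp: "fourier_pair f \<phi>" and k: "integrable lborel k"
    and K: "\<And>t. K t = (LINT x|lborel. k x * cis (2 * pi * x * t))"
  shows "L2inner \<phi> K = L2inner f k"
proof -
  have f: "f x = (LINT t|lborel. \<phi> t * cis (- (2 * pi * x * t)))" for x
    using fp unfolding fourier_pair_def by blast
  have \<phi>: "integrable lborel \<phi>" using fp by (simp add: fourier_pair_def)
  have [measurable]: "\<phi> \<in> borel_measurable lborel" "k \<in> borel_measurable lborel" using \<phi> k by auto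
  have cK: "cnj (K t) = (LINT x|lborel. cnj (k x) * cis (- (2 * pi * x * t)))" for t
    unfolding K by (rule cnj_integral_cis)
  have int: "integrable (lborel \<Otimes>\<^sub>M lborel) (\<lambda>(t, x). \<phi> t * (cnj (k x) * cis (- (2 * pi * x * t))))"
  proof (rule lborel_pair.Fubini_integrable)
    show "(\<lambda>(t, x). \<phi> t * (cnj (k x) * cis (- (2 * pi * x * t)))) \<in> borel_measurable (lborel \<Otimes>\<^sub>M lborel)"
      by measurable
    show "integrable lborel (\<lambda>t. LINT x|lborel. norm (case (t, x) of (t, x) \<Rightarrow> \<phi> t * (cnj (k x) * cis (- (2 * pi * x * t)))))"
      using \<phi> by (simp add: norm_mult)
    show "AE t in lborel. integrable lborel (\<lambda>x. case (t, x) of (t, x) \<Rightarrow> \<phi> t * (cnj (k x) * cis (- (2 * pi * x * t))))"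
      using k by (auto intro!: AE_I2 integrable_mult_right integrable_mult_cis)
  qed
  have "L2inner \<phi> K = (LINT t|lborel. LINT x|lborel. \<phi> t * (cnj (k x) * cis (- (2 * pi * x * t))))"
    unfolding L2inner_def cK by simp
  also have "\<dots> = (LINT x|lborel. LINT t|lborel. \<phi> t * (cnj (k x) * cis (- (2 * pi * x * t))))"
    by (rule lborel_pair.Fubini_integral[symmetric]) (use int in simp)
  also have "\<dots> = (LINT x|lborel. LINT t|lborel. cnj (k x) * (\<phi> t * cis (- (2 * pi * x * t))))"
    by (simp only: mult.left_commute)
  also have "\<dots> = (LINT x|lborel. cnj (k x) * f x)"
    by (simp only: integral_mult_right_zero f[symmetric])
  also have "\<dots> = L2inner f k"
    unfolding L2inner_def by (simp only: mult.commute)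
  finally show ?thesis .
qed

lemma fourier_pair_norm:
  assumes "fourier_pair f \<phi>"
  shows "L2norm_sq \<phi> = L2norm_sq f"
proof -
  have "L2inner \<phi> \<phi> = L2inner f f"
    by (rule fourier_pair_Parseval[OF assms]) (use assms in \<open>unfold fourier_pair_def, blast+\<close>)
  then show ?thesis by (simp add: L2inner_self)
qed

text \<open>Conjugation flips the sign in the kernel and so exchanges the two roles; this is how
  density of the first components yields density of the second.\<close>

lemma fourier_pair_cnj:
  assumes "fourier_pair f \<phi>"
  shows "fourier_pair (\<lambda>x. cnj (\<phi> x)) (\<lambda>x. cnj (f x))"
proof -
  have *: "cnj (f t) = (LINT x|lborel. cnj (\<phi> x) * cis (2 * pi * x * t))"
    "cnj (\<phi> x) = (LINT t|lborel. cnj (f t) * cis (- (2 * pi * x * t)))" for t x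
  proof -
    have "cnj (f t) = cnj (LINT x|lborel. \<phi> x * cis (- (2 * pi * t * x)))"
      using assms unfolding fourier_pair_def by (metis (no_types))
    then show "cnj (f t) = (LINT x|lborel. cnj (\<phi> x) * cis (2 * pi * x * t))"
      unfolding cnj_integral_cis by (simp add: mult_ac)
    have "cnj (\<phi> x) = cnj (LINT t|lborel. f t * cis (2 * pi * t * x))"
      using assms unfolding fourier_pair_def by (metis (no_types))
    then show "cnj (\<phi> x) = (LINT t|lborel. cnj (f t) * cis (- (2 * pi * x * t)))"
      unfolding cnj_integral_cis by (simp add: mult_ac)
  qed
  show ?thesis
    unfolding fourier_pair_def
  proof (intro conjI allI)
    show "integrable lborel (\<lambda>x. cnj (\<phi> x))" "integrable lborel (\<lambda>x. cnj (f x))"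
      using fourier_pairD(1,2)[OF assms] by simp_all
  qed (rule *)+
qed

lemma fourier_pair_add:
  assumes "fourier_pair f \<phi>" "fourier_pair g \<psi>"
  shows "fourier_pair (\<lambda>x. f x + g x) (\<lambda>t. \<phi> t + \<psi> t)"
proof -
  have i: "integrable lborel f" "integrable lborel \<phi>" "integrable lborel g" "integrable lborel \<psi>"
    using fourier_pairD(1,2)[OF assms(1)] fourier_pairD(1,2)[OF assms(2)] by simp_all
  have m: "(\<lambda>x. 2 * pi * x * t) \<in> borel_measurable borel" "(\<lambda>x. - (2 * pi * t * x)) \<in> borel_measurable borel" for t :: real
    by measurable
  show ?thesis
    unfolding fourier_pair_def distrib_right
  proof (intro conjI allI)
    show "\<phi> t + \<psi> t = (LINT x|lborel. f x * cis (2 * pi * x * t) + g x * cis (2 * pi * x * t))" for t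
      unfolding fourier_pairD(3)[OF assms(1), of t] fourier_pairD(3)[OF assms(2), of t]
      by (intro Bochner_Integration.integral_add[symmetric] integrable_mult_cis i m)
    show "f x + g x = (LINT t|lborel. \<phi> t * cis (- (2 * pi * x * t)) + \<psi> t * cis (- (2 * pi * x * t)))" for x
      unfolding fourier_pairD(4)[OF assms(1), of x] fourier_pairD(4)[OF assms(2), of x]
      by (intro Bochner_Integration.integral_add[symmetric] integrable_mult_cis i m)
  qed (simp_all add: i)
qed

lemma fourier_pair_cmult:
  assumes "fourier_pair f \<phi>"
  shows "fourier_pair (\<lambda>x. c * f x) (\<lambda>t. c * \<phi> t)"
  unfolding fourier_pair_def
proof (intro conjI allI)
  show "integrable lborel (\<lambda>x. c * f x)" "integrable lborel (\<lambda>x. c * \<phi> x)"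
    using fourier_pairD(1,2)[OF assms] by simp_all
  have eq: "\<phi> t = (LINT x|lborel. f x * cis (2 * pi * x * t))"
      "f t = (LINT x|lborel. \<phi> x * cis (- (2 * pi * t * x)))" for t
    using assms unfolding fourier_pair_def by blast+
  show "c * \<phi> t = (LINT x|lborel. c * f x * cis (2 * pi * x * t))" for t
    unfolding mult.assoc[of c] integral_mult_right_zero by (subst eq(1)) (rule refl)
  show "c * f x = (LINT t|lborel. c * \<phi> t * cis (- (2 * pi * x * t)))" for x
    unfolding mult.assoc[of c] integral_mult_right_zero by (subst eq(2)) (rule refl)
qed

lemma fourier_pair_sum:
  assumes "finite J" "\<And>j. j \<in> J \<Longrightarrow> fourier_pair (f j) (\<phi> j)"
  shows "fourier_pair (\<lambda>x. \<Sum>j\<in>J. f j x) (\<lambda>t. \<Sum>j\<in>J. \<phi> j t)"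
  using assms
proof (induction J rule: finite_induct)
  case empty
  show ?case by (simp add: fourier_pair_def)
next
  case (insert j J)
  then show ?case by (simp add: fourier_pair_add)
qed

section \<open>Gaussians and the density of Fourier pairs\<close>

definition gauss :: "real \<Rightarrow> real" where
  "gauss x = exp (- (pi * x\<^sup>2))"

lemma gauss_eq_normal_density: "gauss = normal_density 0 (1 / sqrt (2 * pi))"
proof
  fix x
  have s: "(1 / sqrt (2 * pi))\<^sup>2 = 1 / (2 * pi)" by (simp add: power_divide)
  show "gauss x = normal_density 0 (1 / sqrt (2 * pi)) x"
    unfolding normal_density_def gauss_def s by simp
qed

lemma gauss_integrable: "integrable lborel gauss"
  unfolding gauss_eq_normal_density by (rule integrable_normal_density) simp

lemma gauss_measurable [measurable]: "gauss \<in> borel_measurable borel"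
  unfolding gauss_eq_normal_density by measurable

text \<open>Rescaling by c = 1/sqrt(2 pi) turns \<open>gauss\<close> into exp(-x^2/2) and the
  integral into the characteristic function of the standard normal distribution. The constant pi in
  the exponent makes \<open>gauss\<close> its own transform.\<close>

lemma gauss_fourier: "(LINT x|lborel. complex_of_real (gauss x) * cis (2 * pi * x * t)) = complex_of_real (gauss t)"
proof -
  define c where "c = 1 / sqrt (2 * pi)"
  have c: "c > 0" "c\<^sup>2 = 1 / (2 * pi)" "2 * pi * c = sqrt (2 * pi)"
    by (simp_all add: c_def power_divide real_div_sqrt)
  have "(LINT x|lborel. complex_of_real (gauss x) * cis (2 * pi * x * t)) =
      c *\<^sub>R (LINT x|lborel. complex_of_real (gauss (0 + c * x)) * cis (2 * pi * (0 + c * x) * t))"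
    using lborel_integral_real_affine[of c "\<lambda>x. complex_of_real (gauss x) * cis (2 * pi * x * t)" 0] c(1)
    by simp
  also have "\<dots> = (LINT x|lborel. std_normal_density x *\<^sub>R iexp (sqrt (2 * pi) * t * x))"
    unfolding integral_scaleR_right[symmetric]
  proof (rule Bochner_Integration.integral_cong[OF refl])
    fix x
    have "pi * (0 + c * x)\<^sup>2 = x\<^sup>2 / 2" by (simp add: power_mult_distrib c(2))
    then have g: "gauss (0 + c * x) = exp (- x\<^sup>2 / 2)" by (simp add: gauss_def)
    have "2 * pi * (0 + c * x) * t = (2 * pi * c) * t * x" by simp
    then have "cis (2 * pi * (0 + c * x) * t) = iexp (sqrt (2 * pi) * t * x)"
      by (simp only: c(3) cis_conv_exp)
    then show "c *\<^sub>R (complex_of_real (gauss (0 + c * x)) * cis (2 * pi * (0 + c * x) * t)) =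
        std_normal_density x *\<^sub>R iexp (sqrt (2 * pi) * t * x)"
      unfolding g std_normal_density_def c_def[symmetric] by (simp add: scaleR_conv_of_real)
  qed
  also have "\<dots> = char std_normal_distribution (sqrt (2 * pi) * t)"
    unfolding char_def by (subst integral_density) auto
  also have "\<dots> = complex_of_real (gauss t)"
    unfolding char_std_normal_distribution by (simp add: gauss_def power_mult_distrib)
  finally show ?thesis .
qed

text \<open>Modulation becomes translation. The inversion half is the same formula after
  substituting s - a for s, since \<open>gauss\<close> is even and self-dual.\<close>

lemma fourier_pair_gauss:
  "fourier_pair (\<lambda>x. complex_of_real (gauss x) * cis (2 * pi * a * x)) (\<lambda>t. complex_of_real (gauss (t + a)))"
  unfolding fourier_pair_def
proof (intro conjI allI)
  have gi: "integrable lborel (\<lambda>x. complex_of_real (gauss x))" using gauss_integrable by simp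
  show "integrable lborel (\<lambda>x. complex_of_real (gauss x) * cis (2 * pi * a * x))"
    by (rule integrable_mult_cis[OF gi]) measurable
  show "integrable lborel (\<lambda>t. complex_of_real (gauss (t + a)))"
    using lborel_integrable_real_affine[OF gi, of 1 a] by (simp add: add.commute)
  fix t :: real
  show "complex_of_real (gauss (t + a)) =
      (LINT x|lborel. complex_of_real (gauss x) * cis (2 * pi * a * x) * cis (2 * pi * x * t))"
    unfolding mult.assoc cis_mult gauss_fourier[of "t + a", symmetric]
    by (simp add: algebra_simps)
  have even: "gauss (- x) = gauss x" for x by (simp add: gauss_def)
  have "(LINT s|lborel. complex_of_real (gauss (s + a)) * cis (- (2 * pi * t * s))) =
      (LINT s|lborel. complex_of_real (gauss (- a + 1 * s + a)) * cis (- (2 * pi * t * (- a + 1 * s))))"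
    using lborel_integral_real_affine[of 1 "\<lambda>s. complex_of_real (gauss (s + a)) * cis (- (2 * pi * t * s))" "- a"]
    by simp
  also have "\<dots> = (LINT s|lborel. cis (2 * pi * a * t) * (complex_of_real (gauss s) * cis (2 * pi * s * (- t))))"
    by (simp add: mult.left_commute[of "cis _" "complex_of_real _"] cis_mult) (simp add: algebra_simps)
  also have "\<dots> = cis (2 * pi * a * t) * complex_of_real (gauss t)"
    by (simp only: integral_mult_right_zero gauss_fourier even)
  finally show "complex_of_real (gauss t) * cis (2 * pi * a * t) =
      (LINT s|lborel. complex_of_real (gauss (s + a)) * cis (- (2 * pi * t * s)))"
    by (simp add: mult.commute)
qed

text \<open>Truncate \<open>f\<close> to a bounded interval, approximate it by a continuous
  \<open>c\<close>, factor \<open>c\<close> as Gaussian times \<open>k\<close>, and replace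
  \<open>k\<close> by trigonometric polynomials. The Gaussian factor keeps everything integrable on
  the line, and each resulting function is a finite sum of modulated Gaussians, whose transforms are
  explicit.\<close>

lemma L2_dense_fourier_pair: "L2_dense {f. \<exists>\<phi>. fourier_pair f \<phi>}"
  unfolding L2_dense_def
proof (intro conjI ballI allI impI)
  show "L2 d" if "d \<in> {f. \<exists>\<phi>. fourier_pair f \<phi>}" for d
    using that fourier_pair_L2 by blast
  fix f :: "real \<Rightarrow> complex" and \<epsilon> :: real assume f: "L2 f" and \<epsilon>: "\<epsilon> > 0"
  note [measurable] = L2_measurable[OF f]
  define T where "T n x = indicator {- real n<..<real n} x *\<^sub>R f x" for n x
  have [measurable]: "T n \<in> borel_measurable borel" for n unfolding T_def by measurable
  have "(\<lambda>n. L2norm_sq (\<lambda>x. f x - T n x)) \<longlonglongrightarrow> 0"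
  proof (rule L2_tendsto_zero[where h="\<lambda>x. (norm (f x))\<^sup>2"])
    have "eventually (\<lambda>n. f x - T n x = 0) sequentially" for x
    proof -
      obtain N :: nat where N: "\<bar>x\<bar> < real N" using reals_Archimedean2 by blast
      show ?thesis using eventually_ge_at_top[of N]
        by eventually_elim (use N in \<open>auto simp: T_def indicator_def\<close>)
    qed
    then show "AE x in lborel. (\<lambda>n. f x - T n x) \<longlonglongrightarrow> 0"
      by (intro AE_I2 tendsto_eventually)
    show "(norm (f x - T n x))\<^sup>2 \<le> (norm (f x))\<^sup>2" for n x by (simp add: T_def indicator_def)
  qed (use L2_integrable[OF f] in measurable)
  then have "eventually (\<lambda>n. L2norm_sq (\<lambda>x. f x - T n x) < \<epsilon> / 16) sequentially"
    using \<epsilon> by (intro order_tendstoD(2)) auto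
  then obtain M where M: "L2norm_sq (\<lambda>x. f x - T M x) < \<epsilon> / 16"
    by (auto simp: eventually_sequentially)
  have TL: "L2 (T M)"
    by (rule L2_bound(1)[where h="\<lambda>x. (norm (f x))\<^sup>2"])
       (use L2_integrable[OF f] in \<open>auto simp: T_def indicator_def\<close>)
  obtain c where c: "continuous_on UNIV c" "\<And>x. x \<notin> {- real M<..<real M} \<Longrightarrow> c x = 0" "L2 c"
    "L2norm_sq (\<lambda>x. T M x - c x) < \<epsilon> / 16"
    by (rule L2_approx_continuous[OF TL, of "- real M" "real M" "\<epsilon> / 16"]) (use \<epsilon> in \<open>auto simp: T_def\<close>)
  \<comment> \<open>Dividing by the Gaussian is harmless because \<open>c\<close> vanishes outside a
    bounded interval: \<open>k\<close> is again continuous and bounded.\<close>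
  define k where "k x = complex_of_real (exp (pi * x\<^sup>2)) * c x" for x
  have kc: "continuous_on UNIV k" unfolding k_def by (intro continuous_intros c)
  have kg: "complex_of_real (gauss x) * k x = c x" for x
  proof -
    have "exp (- (pi * x\<^sup>2)) * exp (pi * x\<^sup>2) = 1" by (simp add: exp_minus)
    then show ?thesis
      unfolding k_def gauss_def mult.assoc[symmetric] of_real_mult[symmetric] by simp
  qed
  have "bounded (k ` {- real M..real M})"
    by (intro compact_imp_bounded compact_continuous_image continuous_on_subset[OF kc]) auto
  then obtain K0 where K0: "\<And>x. x \<in> {- real M..real M} \<Longrightarrow> norm (k x) \<le> K0"
    unfolding bounded_iff by (metis imageI)
  have kz: "k x = 0" if "x \<notin> {- real M<..<real M}" for x using c(2)[OF that] by (simp add: k_def)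
  define K where "K = max K0 0"
  have K: "norm (k x) \<le> K" for x
    using K0[of x] kz[of x] by (cases "x \<in> {- real M<..<real M}") (auto simp: K_def)
  \<comment> \<open>The period grows with \<open>n\<close>. Since \<open>p n\<close> follows
    \<open>k\<close> on one period only, this covers each fixed point eventually; beyond it only the
    bound on \<open>p n\<close> is available.\<close>
  have "\<exists>p. trig_poly p \<and> (\<forall>x. norm (p x) \<le> K + inverse (Suc n)) \<and>
      (\<forall>x\<in>{- real (M + Suc n)..real (M + Suc n)}. norm (k x - p (2 * pi * x / (2 * real (M + Suc n)))) < inverse (Suc n))" for n
  proof -
    have "- real (M + Suc n) < real (M + Suc n)" by simp
    moreover have "k (- real (M + Suc n)) = k (real (M + Suc n))" by (simp add: kz)
    ultimately show ?thesis
      by (rule trig_poly_approx[OF _ continuous_on_subset[OF kc subset_UNIV], of _ _ "inverse (Suc n)" K])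
        (use K in \<open>auto simp del: of_nat_Suc\<close>)
  qed
  then have "\<forall>n. \<exists>p. trig_poly p \<and> (\<forall>x. norm (p x) \<le> K + inverse (Suc n)) \<and>
      (\<forall>x\<in>{- real (M + Suc n)..real (M + Suc n)}. norm (k x - p (2 * pi * x / (2 * real (M + Suc n)))) < inverse (Suc n))" ..
  then obtain p where p: "\<And>n. trig_poly (p n)" "\<And>n x. norm (p n x) \<le> K + inverse (Suc n)"
    "\<And>n x. x \<in> {- real (M + Suc n)..real (M + Suc n)} \<Longrightarrow>
      norm (k x - p n (2 * pi * x / (2 * real (M + Suc n)))) < inverse (Suc n)"
    unfolding choice_iff by blast
  define r where "r n x = complex_of_real (gauss x) * p n (2 * pi * x / (2 * real (M + Suc n)))" for n x
  have r_pair: "\<exists>\<phi>. fourier_pair (r n) \<phi>" for n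
  proof -
    obtain J d where J: "finite J" "\<And>x. p n x = (\<Sum>j\<in>J. d j * cis (real_of_int j * x))"
      using p(1)[of n] unfolding trig_poly_def by auto
    have "r n = (\<lambda>x. \<Sum>j\<in>J. d j * (complex_of_real (gauss x) * cis (2 * pi * (real_of_int j / (2 * real (M + Suc n))) * x)))"
      unfolding r_def J(2) sum_distrib_left by (intro ext sum.cong refl) (simp add: mult_ac)
    moreover have "fourier_pair \<dots> (\<lambda>t. \<Sum>j\<in>J. d j * complex_of_real (gauss (t + real_of_int j / (2 * real (M + Suc n)))))"
      by (intro fourier_pair_sum J fourier_pair_cmult fourier_pair_gauss)
    ultimately show ?thesis by (intro exI) (simp only:)
  qed
  then have rL: "L2 (r n)" for n using fourier_pair_L2 by blast
  note [measurable] = L2_measurable[OF rL] L2_measurable[OF c(3)]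
  have "(\<lambda>n. L2norm_sq (\<lambda>x. c x - r n x)) \<longlonglongrightarrow> 0"
  \<comment> \<open>The majorant: |k - p n| is at most K + (K + 1) everywhere, and the square of
    \<open>gauss\<close> is at most \<open>gauss\<close>.\<close>
  proof (rule L2_tendsto_zero[where h="\<lambda>x. (2 * K + 1)\<^sup>2 * gauss x"])
    show "integrable lborel (\<lambda>x. (2 * K + 1)\<^sup>2 * gauss x)" using gauss_integrable by simp
    have eq: "c x - r n x = complex_of_real (gauss x) * (k x - p n (2 * pi * x / (2 * real (M + Suc n))))" for n x
      by (simp only: right_diff_distrib kg r_def)
    have g01: "0 \<le> gauss x" "gauss x \<le> 1" for x by (auto simp: gauss_def)
    show "(norm (c x - r n x))\<^sup>2 \<le> (2 * K + 1)\<^sup>2 * gauss x" for n x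
    proof -
      have "inverse (real (Suc n)) \<le> 1" by (simp add: field_simps)
      then have "norm (k x - p n (2 * pi * x / (2 * real (M + Suc n)))) \<le> 2 * K + 1"
        using norm_triangle_ineq4[of "k x" "p n (2 * pi * x / (2 * real (M + Suc n)))"] K[of x]
          p(2)[of n "2 * pi * x / (2 * real (M + Suc n))"] by linarith
      then have "(norm (c x - r n x))\<^sup>2 \<le> (gauss x)\<^sup>2 * (2 * K + 1)\<^sup>2"
        unfolding eq norm_mult power_mult_distrib using g01 by (intro mult_mono power_mono) auto
      also have "\<dots> \<le> gauss x * (2 * K + 1)\<^sup>2"
        using g01[of x] by (intro mult_right_mono) (auto simp: power2_eq_square intro: mult_left_le)
      finally show ?thesis by (simp add: mult.commute)
    qed
    have "(\<lambda>n. c x - r n x) \<longlonglongrightarrow> 0" for x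
    proof (rule Lim_null_comparison[OF _ LIMSEQ_inverse_real_of_nat])
      obtain N :: nat where N: "\<bar>x\<bar> \<le> real N" using real_arch_simple by blast
      show "eventually (\<lambda>n. norm (c x - r n x) \<le> inverse (real (Suc n))) sequentially"
        using eventually_ge_at_top[of N]
      proof eventually_elim
        case (elim n)
        then have "x \<in> {- real (M + Suc n)..real (M + Suc n)}" using N by auto
        from less_imp_le[OF p(3)[OF this]] show ?case
          unfolding eq norm_mult using g01[of x]
          by (metis (no_types, opaque_lifting) abs_of_nonneg mult_left_le_one_le norm_ge_zero norm_of_real order_trans)
      qed
    qed
    then show "AE x in lborel. (\<lambda>n. c x - r n x) \<longlonglongrightarrow> 0" by simp
  qed measurable
  then have "eventually (\<lambda>n. L2norm_sq (\<lambda>x. c x - r n x) < \<epsilon> / 16) sequentially"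
    using \<epsilon> by (intro order_tendstoD(2)) auto
  then obtain n where n: "L2norm_sq (\<lambda>x. c x - r n x) < \<epsilon> / 16"
    by (auto simp: eventually_sequentially)
  have "L2norm_sq (\<lambda>x. T M x - r n x) < \<epsilon> / 4"
    using L2_add(2)[OF L2_diff(1)[OF TL c(3)] L2_diff(1)[OF c(3) rL[of n]]] c(4) n by simp
  then have "L2norm_sq (\<lambda>x. f x - r n x) < \<epsilon>"
    using L2_add(2)[OF L2_diff(1)[OF f TL] L2_diff(1)[OF TL rL[of n]]] M \<epsilon> by simp
  then show "\<exists>d\<in>{f. \<exists>\<phi>. fourier_pair f \<phi>}. L2norm_sq (\<lambda>x. f x - d x) < \<epsilon>"
    using r_pair by blast
qed

lemma L2_dense_fourier_pair_snd: "L2_dense {\<phi>. \<exists>f. fourier_pair f \<phi>}"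
  unfolding L2_dense_def
proof (intro conjI ballI allI impI)
  show "L2 d" if "d \<in> {\<phi>. \<exists>f. fourier_pair f \<phi>}" for d
    using that fourier_pair_L2 by blast
  fix f :: "real \<Rightarrow> complex" and \<epsilon> :: real assume f: "L2 f" and \<epsilon>: "\<epsilon> > 0"
  obtain d \<phi> where d: "fourier_pair d \<phi>" "L2norm_sq (\<lambda>x. cnj (f x) - d x) < \<epsilon>"
    using L2_dense_fourier_pair L2_cnj[OF f] \<epsilon> unfolding L2_dense_def by blast
  have "L2norm_sq (\<lambda>x. f x - cnj (d x)) = L2norm_sq (\<lambda>x. cnj (f x) - d x)"
    using L2norm_sq_cnj[of "\<lambda>x. cnj (f x) - d x"] by simp
  then show "\<exists>d\<in>{\<phi>. \<exists>f. fourier_pair f \<phi>}. L2norm_sq (\<lambda>x. f x - d x) < \<epsilon>"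
    using d(2) fourier_pair_cnj[OF d(1)] by (intro bexI[of _ "\<lambda>x. cnj (d x)"]) auto
qed

section \<open>The Fourier transform of the Gabor system\<close>

text \<open>On a Fourier pair the coefficients and the norms on the two sides agree. Both components
  range over dense sets, so each frame property can be tested there.\<close>

lemma frame_fourier_transfer:
  fixes gs hs :: "'i \<Rightarrow> real \<Rightarrow> complex"
  assumes "\<And>j. L2 (gs j)" "\<And>j. L2 (hs j)" "\<And>j. integrable lborel (hs j)"
    and "\<And>j t. gs j t = (LINT x|lborel. hs j x * cis (2 * pi * x * t))"
  shows "frame gs \<longleftrightarrow> frame hs"
proof -
  have s: "frame_sum gs \<phi> = frame_sum hs f" if "fourier_pair f \<phi>" for f \<phi>
  proof -
    have "L2inner \<phi> (gs j) = L2inner f (hs j)" for j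
      by (rule fourier_pair_Parseval[OF that]) (rule assms)+
    then show ?thesis by (simp add: frame_sum_def)
  qed
  have "frame gs \<longleftrightarrow> frame_on {\<phi>. \<exists>f. fourier_pair f \<phi>} gs"
    by (rule frame_on_dense[OF L2_dense_fourier_pair_snd]) (rule assms)
  also have "\<dots> \<longleftrightarrow> frame_on {f. \<exists>\<phi>. fourier_pair f \<phi>} hs"
    unfolding frame_on_def
  proof (intro ex_cong1 conj_cong refl)
    fix A B :: real
    have "(ennreal (A * L2norm_sq \<phi>) \<le> frame_sum gs \<phi> \<and> frame_sum gs \<phi> \<le> ennreal (B * L2norm_sq \<phi>)) \<longleftrightarrow>
      (ennreal (A * L2norm_sq f) \<le> frame_sum hs f \<and> frame_sum hs f \<le> ennreal (B * L2norm_sq f))"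
      if "fourier_pair f \<phi>" for f \<phi>
      using s[OF that] fourier_pair_norm[OF that] by simp
    then show "(\<forall>f\<in>{\<phi>. \<exists>f. fourier_pair f \<phi>}. ennreal (A * L2norm_sq f) \<le> frame_sum gs f \<and> frame_sum gs f \<le> ennreal (B * L2norm_sq f)) \<longleftrightarrow>
      (\<forall>f\<in>{f. \<exists>\<phi>. fourier_pair f \<phi>}. ennreal (A * L2norm_sq f) \<le> frame_sum hs f \<and> frame_sum hs f \<le> ennreal (B * L2norm_sq f))"
      by blast
  qed
  also have "\<dots> \<longleftrightarrow> frame hs"
    by (rule frame_on_dense[OF L2_dense_fourier_pair, symmetric]) (rule assms)
  finally show ?thesis .
qed

section \<open>One-sided exponentials and their transforms\<close>

definition decay :: "real \<Rightarrow> real \<Rightarrow> real \<Rightarrow> real" where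
  "decay w b x = (if b < x then exp (2 * pi * w * (x - b)) else 0)"

lemma decay_measurable [measurable]: "decay w b \<in> borel_measurable borel"
  unfolding decay_def by measurable

lemma decay_bounds:
  assumes "w < 0"
  shows "0 \<le> decay w b x" "decay w b x \<le> 1"
  using assms by (auto simp: decay_def mult_le_0_iff)

lemma decay_integrable:
  assumes "w < 0"
  shows "integrable lborel (decay w b)" "(LINT x|lborel. decay w b x) = (LINT x|lborel. decay w 0 x)"
proof -
  have "set_integrable lborel {0<..} (\<lambda>x. exp (- (x * (- (2 * pi * w)))))"
    by (rule integrable_I0i_exp_mscale) (use assms in \<open>simp add: mult_pos_neg\<close>)
  then have 0: "integrable lborel (decay w 0)"
    unfolding set_integrable_def
    by (rule Bochner_Integration.integrable_cong[THEN iffD1, rotated 2])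
       (auto simp: decay_def indicator_def mult_ac)
  have eq: "decay w b x = decay w 0 (- b + 1 * x)" for x by (auto simp: decay_def)
  show "integrable lborel (decay w b)"
    using lborel_integrable_real_affine[OF 0, of 1 "- b"] unfolding eq[symmetric] by simp
  show "(LINT x|lborel. decay w b x) = (LINT x|lborel. decay w 0 x)"
    using lborel_integral_real_affine[of 1 "decay w 0" "- b"] unfolding eq[symmetric] by simp
qed

text \<open>With c = 2 pi (w + i t) the integrand on the half line is exp(c x). Its antiderivative
  exp(c x)/c vanishes at infinity because Re c = 2 pi w < 0.\<close>

lemma decay_fourier_0:
  assumes w: "w < 0"
  shows "(LINT x|lborel. complex_of_real (decay w 0 x) * cis (2 * pi * x * t)) =
    - (1 / (2 * pi * (complex_of_real w + \<i> * complex_of_real t)))"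
proof -
  define c where "c = 2 * pi * (complex_of_real w + \<i> * complex_of_real t)"
  have Rec: "Re c = 2 * pi * w" "Im c = 2 * pi * t" by (simp_all add: c_def)
  have c0: "c \<noteq> 0" using w Rec(1) by auto
  define f where "f x = exp (c * complex_of_real x)" for x :: real
  define F where "F x = f x / c" for x
  have f_eq: "f x = complex_of_real (exp (2 * pi * w * x)) * cis (2 * pi * x * t)" for x
  proof -
    have "f x = complex_of_real (exp (Re (c * complex_of_real x))) * cis (Im (c * complex_of_real x))"
      unfolding f_def by (simp only: exp_eq_polar)
    then show ?thesis by (simp add: Rec mult_ac)
  qed
  have dF: "(F has_vector_derivative f x) (at x)" for x
  proof -
    have "((\<lambda>z. exp (c * z) / c) has_field_derivative exp (c * complex_of_real x)) (at (complex_of_real x))"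
      using c0 by (auto intro!: derivative_eq_intros)
    from has_vector_derivative_real_field[OF this] show ?thesis
      unfolding F_def[abs_def] f_def by simp
  qed
  have ind: "complex_of_real (decay w 0 x) * cis (2 * pi * x * t) = indicator (einterval 0 \<infinity>) x *\<^sub>R f x" for x
    by (auto simp: decay_def f_eq indicator_def einterval_def zero_ereal_def)
  have int: "integrable lborel (\<lambda>x. complex_of_real (decay w 0 x) * cis (2 * pi * x * t))"
    by (rule integrable_mult_cis) (use decay_integrable(1)[OF w, of 0] in simp_all)
  have "(LBINT x=0..\<infinity>. f x) = 0 - F 0"
  proof (rule interval_integral_FTC_integrable)
    show "set_integrable lborel (einterval 0 \<infinity>) f"
      unfolding set_integrable_def ind[symmetric] by (rule int)
    show "isCont f x" for x unfolding f_def by (intro continuous_intros)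
    have "isCont F 0" using dF by (rule has_vector_derivative_continuous)
    then show "((F \<circ> real_of_ereal) \<longlongrightarrow> F 0) (at_right 0)"
      by (simp add: zero_ereal_def ereal_tendsto_simps isCont_def filterlim_at_split)
    have "((\<lambda>x. inverse (norm c) * exp (2 * pi * w * x)) \<longlongrightarrow> inverse (norm c) * 0) at_top"
    proof (intro tendsto_mult tendsto_const filterlim_compose[OF exp_at_bot])
      show "filterlim (\<lambda>x. 2 * pi * w * x) at_bot at_top"
        by (rule filterlim_tendsto_neg_mult_at_bot[OF tendsto_const _ filterlim_ident]) (use w in \<open>simp add: mult_pos_neg\<close>)
    qed
    then have "((\<lambda>x. norm (F x)) \<longlongrightarrow> 0) at_top"
      by (simp add: F_def f_eq norm_divide norm_mult divide_inverse norm_inverse mult.commute)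
    then have "(F \<longlongrightarrow> 0) at_top" by (rule tendsto_norm_zero_cancel)
    then show "((F \<circ> real_of_ereal) \<longlongrightarrow> 0) (at_left \<infinity>)"
      by (simp add: ereal_tendsto_simps)
  qed (use dF in auto)
  moreover have "(LBINT x=0..\<infinity>. f x) = (LINT x|lborel. complex_of_real (decay w 0 x) * cis (2 * pi * x * t))"
    unfolding ind by (simp add: interval_lebesgue_integral_def set_lebesgue_integral_def)
  ultimately show ?thesis by (simp add: F_def f_def c_def)
qed

lemma decay_fourier:
  assumes w: "w < 0"
  shows "(LINT x|lborel. complex_of_real (decay w b x) * cis (2 * pi * x * t)) =
    - (cis (2 * pi * b * t) / (2 * pi * (complex_of_real w + \<i> * complex_of_real t)))"
proof -
  have eq: "decay w b (b + 1 * x) = decay w 0 x" for x by (auto simp: decay_def)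
  have "(LINT x|lborel. complex_of_real (decay w b x) * cis (2 * pi * x * t)) =
      (LINT x|lborel. complex_of_real (decay w b (b + 1 * x)) * cis (2 * pi * (b + 1 * x) * t))"
    using lborel_integral_real_affine[of 1 "\<lambda>x. complex_of_real (decay w b x) * cis (2 * pi * x * t)" b] by simp
  also have "\<dots> = (LINT x|lborel. cis (2 * pi * b * t) * (complex_of_real (decay w 0 x) * cis (2 * pi * x * t)))"
    unfolding eq
  proof (rule Bochner_Integration.integral_cong[OF refl])
    fix x
    have "cis (2 * pi * (b + 1 * x) * t) = cis (2 * pi * b * t) * cis (2 * pi * x * t)"
      by (simp add: cis_mult algebra_simps)
    then show "complex_of_real (decay w 0 x) * cis (2 * pi * (b + 1 * x) * t) =
        cis (2 * pi * b * t) * (complex_of_real (decay w 0 x) * cis (2 * pi * x * t))"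
      by (simp only: mult.left_commute)
  qed
  finally show ?thesis by (simp add: decay_fourier_0[OF w])
qed

section \<open>The window as a Fourier transform\<close>

locale rational_window =
  fixes \<alpha> w :: real and a :: "nat \<Rightarrow> complex" and b :: "nat \<Rightarrow> real" and g :: "real \<Rightarrow> complex"
  assumes \<alpha>: "\<alpha> > 0" and w: "w < 0" and a: "summable (\<lambda>k. norm (a k))"
    and g: "\<And>t. g t = (\<Sum>k. a k * exp (complex_of_real (2 * pi * b k * t) * \<i>)) /
      (complex_of_real t - \<i> * complex_of_real w)"
begin

text \<open>The function p of the overview; \<open>window_fourier\<close> shows that -2 pi i times
  it has transform \<open>g\<close>.\<close>

definition profile :: "real \<Rightarrow> complex" where
  "profile x = (\<Sum>k. a k * complex_of_real (decay w (b k) x))"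

text \<open>In \<open>gabor\<close> the modulation by \<open>m\<close> is applied after the
  translation by \<alpha> n. On this side the translation by \<open>m\<close> therefore also acts on
  the phase, which is why x - m stands in the exponential.\<close>

definition gabor_hat :: "int \<Rightarrow> int \<Rightarrow> real \<Rightarrow> complex" where
  "gabor_hat m n x = (- 2 * pi * \<i>) * profile (x - real_of_int m) * cis (- (2 * pi * \<alpha> * real_of_int n * (x - real_of_int m)))"

lemma summable_mult_bounded:
  assumes "\<And>k. norm (c k) \<le> C"
  shows "summable (\<lambda>k. norm (a k * c k))" "summable (\<lambda>k. a k * c k)"
    "norm (\<Sum>k. a k * c k) \<le> (\<Sum>k. norm (a k)) * C"
proof -
  have le: "norm (a k * c k) \<le> norm (a k) * C" for k
    unfolding norm_mult by (intro mult_left_mono assms) simp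
  have s: "summable (\<lambda>k. norm (a k) * C)" by (rule summable_mult2[OF a])
  show 1: "summable (\<lambda>k. norm (a k * c k))"
    by (rule summable_comparison_test'[OF s, of 0]) (use le in simp)
  then show "summable (\<lambda>k. a k * c k)" by (rule summable_norm_cancel)
  have "norm (\<Sum>k. a k * c k) \<le> (\<Sum>k. norm (a k * c k))" by (rule summable_norm[OF 1])
  also have "\<dots> \<le> (\<Sum>k. norm (a k) * C)" by (rule suminf_le[OF le 1 s])
  also have "\<dots> = (\<Sum>k. norm (a k)) * C" by (rule suminf_mult2[OF a, symmetric])
  finally show "norm (\<Sum>k. a k * c k) \<le> (\<Sum>k. norm (a k)) * C" .
qed

lemma profile_measurable [measurable]: "profile \<in> borel_measurable borel"
  unfolding profile_def by measurable

lemma profile_bounded: "norm (profile x) \<le> (\<Sum>k. norm (a k))"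
  unfolding profile_def
  using summable_mult_bounded(3)[of "\<lambda>k. complex_of_real (decay w (b k) x)" 1] decay_bounds[OF w]
  by simp

text \<open>The L^1 norm of \<open>decay w b\<close> does not depend on \<open>b\<close>, so the
  series converges in L^1 with the sum of |a_k| as weight and may be integrated term by
  term.\<close>

lemma profile_integrable: "integrable lborel profile"
  and profile_fourier: "(LINT x|lborel. profile x * cis (2 * pi * x * t)) =
    (\<Sum>k. a k * (LINT x|lborel. complex_of_real (decay w (b k) x) * cis (2 * pi * x * t)))"
proof -
  have di: "integrable lborel (\<lambda>x. complex_of_real (decay w (b k) x))" for k
    using decay_integrable(1)[OF w] by simp
  have i: "integrable lborel (\<lambda>x. a k * (complex_of_real (decay w (b k) x) * cis (2 * pi * x * t)))" for k t
    by (intro integrable_mult_right integrable_mult_cis di) measurable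
  have n: "norm (a k * (complex_of_real (decay w (b k) x) * cis (2 * pi * x * t))) = norm (a k) * decay w (b k) x" for k t x
    using decay_bounds[OF w] by (simp add: norm_mult)
  have s1: "summable (\<lambda>k. norm (a k * (complex_of_real (decay w (b k) x) * cis (2 * pi * x * t))))" for x t
    by (rule summable_mult_bounded(1)[of _ 1]) (use decay_bounds[OF w] in \<open>simp add: norm_mult\<close>)
  have s2: "summable (\<lambda>k. LINT x|lborel. norm (a k * (complex_of_real (decay w (b k) x) * cis (2 * pi * x * t))))" for t
  proof -
    have "(LINT x|lborel. norm (a k * (complex_of_real (decay w (b k) x) * cis (2 * pi * x * t)))) =
        norm (a k) * (LINT x|lborel. decay w 0 x)" for k
      unfolding n integral_mult_right_zero decay_integrable(2)[OF w, of "b k"] ..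
    then show ?thesis by (simp only: summable_mult2[OF a])
  qed
  have p: "profile x * cis (2 * pi * x * t) = (\<Sum>k. a k * (complex_of_real (decay w (b k) x) * cis (2 * pi * x * t)))" for x t
  proof -
    have "summable (\<lambda>k. a k * complex_of_real (decay w (b k) x))"
      by (rule summable_mult_bounded(2)[of _ 1]) (use decay_bounds[OF w] in simp)
    from suminf_mult2[OF this] show ?thesis by (simp add: profile_def mult.assoc)
  qed
  have "integrable lborel (\<lambda>x. profile x * cis (2 * pi * x * 0))"
    unfolding p by (rule integrable_suminf[OF i _ s2]) (intro AE_I2 s1)
  then show "integrable lborel profile" by simp
  show "(LINT x|lborel. profile x * cis (2 * pi * x * t)) =
    (\<Sum>k. a k * (LINT x|lborel. complex_of_real (decay w (b k) x) * cis (2 * pi * x * t)))"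
    unfolding p by (subst integral_suminf[OF i _ s2]) (use s1 in simp_all)
qed

lemma window_fourier: "(LINT x|lborel. (- 2 * pi * \<i>) * profile x * cis (2 * pi * x * t)) = g t"
proof -
  let ?D = "complex_of_real w + \<i> * complex_of_real t"
  have D: "?D \<noteq> 0" using w by (auto simp: complex_eq_iff)
  \<comment> \<open>This identity is where the constant -2 pi i comes from: it turns -1/(2 pi (w + i
    t)) into 1/(t - iw).\<close>
  have D': "complex_of_real t - \<i> * complex_of_real w = - \<i> * ?D" by (simp add: algebra_simps)
  have const: "(- 2 * pi * \<i>) * (S * (- (1 / (2 * pi * z)))) = S / (- \<i> * z)" if "z \<noteq> 0" for S z :: complex
    using that by (simp add: field_simps)
  have s: "summable (\<lambda>k. a k * cis (2 * pi * b k * t))"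
    by (rule summable_mult_bounded(2)[of _ 1]) simp
  have "(LINT x|lborel. (- 2 * pi * \<i>) * profile x * cis (2 * pi * x * t)) =
      (- 2 * pi * \<i>) * (\<Sum>k. a k * (- (cis (2 * pi * b k * t) / (2 * pi * ?D))))"
    unfolding mult.assoc[of "- 2 * pi * \<i>"] integral_mult_right_zero profile_fourier decay_fourier[OF w] ..
  also have "(\<lambda>k. a k * (- (cis (2 * pi * b k * t) / (2 * pi * ?D)))) =
      (\<lambda>k. a k * cis (2 * pi * b k * t) * (- (1 / (2 * pi * ?D))))" by (simp add: fun_eq_iff)
  also have "(- 2 * pi * \<i>) * (\<Sum>k. a k * cis (2 * pi * b k * t) * (- (1 / (2 * pi * ?D)))) =
      (- 2 * pi * \<i>) * ((\<Sum>k. a k * cis (2 * pi * b k * t)) * (- (1 / (2 * pi * ?D))))"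
    by (simp only: suminf_mult2[OF s])
  also have "\<dots> = (\<Sum>k. a k * cis (2 * pi * b k * t)) / (complex_of_real t - \<i> * complex_of_real w)"
    unfolding D' by (rule const[OF D])
  also have "\<dots> = g t" unfolding g by (simp add: cis_conv_exp mult.commute)
  finally show ?thesis .
qed

lemma gabor_hat_integrable: "integrable lborel (gabor_hat m n)"
proof -
  have "integrable lborel (\<lambda>x. (- 2 * pi * \<i>) * profile (- real_of_int m + 1 * x))"
    using lborel_integrable_real_affine[OF profile_integrable, of 1 "- real_of_int m"] by simp
  then have "integrable lborel (\<lambda>x. (- 2 * pi * \<i>) * profile (x - real_of_int m))" by simp
  then show ?thesis unfolding gabor_hat_def[abs_def] by (rule integrable_mult_cis) measurable
qed

lemma gabor_hat_L2: "L2 (gabor_hat m n)"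
proof (rule L2_bounded_integrable[OF gabor_hat_integrable])
  show "norm (gabor_hat m n x) \<le> 2 * pi * (\<Sum>k. norm (a k))" for x
    using profile_bounded[of "x - real_of_int m"] by (simp add: gabor_hat_def norm_mult)
qed

lemma gabor_hat_fourier: "gabor g \<alpha> m n t = (LINT x|lborel. gabor_hat m n x * cis (2 * pi * x * t))"
proof -
  have "(LINT x|lborel. gabor_hat m n x * cis (2 * pi * x * t)) =
      (LINT x|lborel. gabor_hat m n (real_of_int m + 1 * x) * cis (2 * pi * (real_of_int m + 1 * x) * t))"
    using lborel_integral_real_affine[of 1 "\<lambda>x. gabor_hat m n x * cis (2 * pi * x * t)" "real_of_int m"] by simp
  also have "\<dots> = (LINT x|lborel. cis (2 * pi * real_of_int m * t) *
      ((- 2 * pi * \<i>) * profile x * cis (2 * pi * x * (t - \<alpha> * real_of_int n))))"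
  proof (rule Bochner_Integration.integral_cong[OF refl])
    fix x
    have "cis (- (2 * pi * \<alpha> * real_of_int n * x)) * cis (2 * pi * (real_of_int m + 1 * x) * t) =
        cis (2 * pi * real_of_int m * t) * cis (2 * pi * x * (t - \<alpha> * real_of_int n))"
      unfolding cis_mult by (simp add: algebra_simps)
    then show "gabor_hat m n (real_of_int m + 1 * x) * cis (2 * pi * (real_of_int m + 1 * x) * t) =
      cis (2 * pi * real_of_int m * t) * ((- 2 * pi * \<i>) * profile x * cis (2 * pi * x * (t - \<alpha> * real_of_int n)))"
      by (simp add: gabor_hat_def mult_ac)
  qed
  also have "\<dots> = cis (2 * pi * real_of_int m * t) * g (t - \<alpha> * real_of_int n)"
    by (simp only: integral_mult_right_zero window_fourier)
  finally show ?thesis by (simp add: gabor_def cis_conv_exp mult.commute)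
qed

lemma window_L2: "L2 g"
proof (rule L2_bound(1))
  let ?S = "\<Sum>k. norm (a k)"
  show "g \<in> borel_measurable borel" unfolding g[abs_def] by measurable
  have "integrable lborel (\<lambda>x::real. inverse (1 + x\<^sup>2))"
    using integrable_inverse_1_plus_square by (simp add: set_integrable_def)
  from lborel_integrable_real_affine[OF this, of "1 / w" 0]
  show "integrable lborel (\<lambda>x. ?S\<^sup>2 / w\<^sup>2 * inverse (1 + (0 + 1 / w * x)\<^sup>2))"
    using w by simp
  show "(norm (g t))\<^sup>2 \<le> ?S\<^sup>2 / w\<^sup>2 * inverse (1 + (0 + 1 / w * t)\<^sup>2)" for t
  proof -
    have n: "(norm (complex_of_real t - \<i> * complex_of_real w))\<^sup>2 = t\<^sup>2 + w\<^sup>2"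
      by (simp add: cmod_power2)
    have "norm (\<Sum>k. a k * exp (complex_of_real (2 * pi * b k * t) * \<i>)) \<le> ?S * 1"
      by (rule summable_mult_bounded(3)) (simp add: norm_exp_eq_Re)
    then have "(norm (g t))\<^sup>2 \<le> ?S\<^sup>2 / (t\<^sup>2 + w\<^sup>2)"
      unfolding g norm_divide power_divide n by (intro divide_right_mono power_mono) auto
    also have "\<dots> = ?S\<^sup>2 / w\<^sup>2 * inverse (1 + (0 + 1 / w * t)\<^sup>2)"
    proof -
      have "w\<^sup>2 * (1 + (0 + 1 / w * t)\<^sup>2) = t\<^sup>2 + w\<^sup>2"
        using w by (simp add: power_divide distrib_left)
      then show ?thesis by (simp add: divide_inverse flip: mult.assoc inverse_mult_distrib)
    qed
    finally show ?thesis .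
  qed
qed

lemma gabor_L2: "L2 (gabor g \<alpha> m n)"
proof -
  have "L2 (\<lambda>t. exp (complex_of_real (2 * pi * real_of_int m * t) * \<i>) * g (t + - (\<alpha> * real_of_int n)))"
    by (rule L2_mult_bounded(1)[OF L2_shift(1)[OF window_L2], of _ 1]) (auto simp: norm_exp_eq_Re)
  then show ?thesis by (simp add: gabor_def[abs_def])
qed

lemma frame_gabor_iff_frame_gabor_hat:
  "frame (\<lambda>(m, n). gabor g \<alpha> m n) \<longleftrightarrow> frame (\<lambda>(m, n). gabor_hat m n)"
proof (rule frame_fourier_transfer)
  fix j :: "int \<times> int"
  show "L2 (case j of (m, n) \<Rightarrow> gabor g \<alpha> m n)" "L2 (case j of (m, n) \<Rightarrow> gabor_hat m n)"
    "integrable lborel (case j of (m, n) \<Rightarrow> gabor_hat m n)"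
    "(case j of (m, n) \<Rightarrow> gabor g \<alpha> m n) t =
       (LINT x|lborel. (case j of (m, n) \<Rightarrow> gabor_hat m n) x * cis (2 * pi * x * t))" for t
    by (auto simp: gabor_L2 gabor_hat_L2 gabor_hat_integrable gabor_hat_fourier split: prod.split)
qed

end

section \<open>Weighted series and cyclic shifts\<close>

lemma AE_summable_of_summable_integrals:
  fixes f :: "nat \<Rightarrow> 'a \<Rightarrow> real"
  assumes i: "\<And>k. integrable M (f k)" and pos: "\<And>k x. 0 \<le> f k x"
    and s: "summable (\<lambda>k. integral\<^sup>L M (f k))"
  shows "AE x in M. summable (\<lambda>k. f k x)"
proof -
  have [measurable]: "f k \<in> borel_measurable M" for k using i[of k] by auto
  have "(\<integral>\<^sup>+ x. (\<Sum>k. ennreal (f k x)) \<partial>M) = (\<Sum>k. \<integral>\<^sup>+ x. ennreal (f k x) \<partial>M)"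
    by (intro nn_integral_suminf) measurable
  also have "\<dots> = (\<Sum>k. ennreal (integral\<^sup>L M (f k)))"
    using i pos by (simp add: nn_integral_eq_integral)
  also have "\<dots> = ennreal (\<Sum>k. integral\<^sup>L M (f k))"
    using pos by (intro suminf_ennreal2 s) (simp add: integral_nonneg_AE)
  finally have "(\<integral>\<^sup>+ x. (\<Sum>k. ennreal (f k x)) \<partial>M) \<noteq> \<infinity>" by simp
  then have "AE x in M. (\<Sum>k. ennreal (f k x)) \<noteq> \<infinity>"
    by (intro nn_integral_PInf_AE) measurable
  then show ?thesis
    by eventually_elim (rule summable_suminf_not_top, auto simp: pos)
qed

text \<open>Cauchy-Schwarz for the factorisation of |a z| into sqrt |a| and sqrt |a| |z|, on partial
  sums first.\<close>

lemma suminf_Cauchy_Schwarz: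
  fixes a z :: "nat \<Rightarrow> complex"
  assumes a: "summable (\<lambda>k. norm (a k))" and az: "summable (\<lambda>k. norm (a k) * (norm (z k))\<^sup>2)"
  shows "summable (\<lambda>k. norm (a k * z k))"
    and "(norm (\<Sum>k. a k * z k))\<^sup>2 \<le> (\<Sum>k. norm (a k)) * (\<Sum>k. norm (a k) * (norm (z k))\<^sup>2)"
proof -
  let ?S = "\<Sum>k. norm (a k)" and ?Q = "\<Sum>k. norm (a k) * (norm (z k))\<^sup>2"
  have le: "norm (a k * z k) \<le> norm (a k) + norm (a k) * (norm (z k))\<^sup>2" for k
  proof -
    have "norm (z k) \<le> 1 + (norm (z k))\<^sup>2"
      using sum_squares_bound[of "norm (z k)" 1] norm_ge_zero[of "z k"] unfolding power_one by linarith
    from mult_left_mono[OF this norm_ge_zero[of "a k"]] show ?thesis by (simp add: norm_mult distrib_left)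
  qed
  show s: "summable (\<lambda>k. norm (a k * z k))"
    by (rule summable_comparison_test'[OF summable_add[OF a az], of 0]) (use le in simp)
  have SQ: "0 \<le> ?S * ?Q" by (intro mult_nonneg_nonneg suminf_nonneg a az) auto
  have "(\<Sum>k<n. norm (a k * z k)) \<le> sqrt (?S * ?Q)" for n
  proof (rule real_le_rsqrt)
    have "(\<Sum>k<n. norm (a k * z k)) = (\<Sum>k<n. sqrt (norm (a k)) * (sqrt (norm (a k)) * norm (z k)))"
      by (simp add: norm_mult mult.assoc[symmetric])
    then have "(\<Sum>k<n. norm (a k * z k))\<^sup>2 \<le> (\<Sum>k<n. (sqrt (norm (a k)))\<^sup>2) * (\<Sum>k<n. (sqrt (norm (a k)) * norm (z k))\<^sup>2)"
      using Cauchy_Schwarz_ineq_sum by metis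
    also have "\<dots> = (\<Sum>k<n. norm (a k)) * (\<Sum>k<n. norm (a k) * (norm (z k))\<^sup>2)"
      by (simp add: power_mult_distrib)
    also have "\<dots> \<le> ?S * ?Q"
      by (intro mult_mono sum_le_suminf a az suminf_nonneg sum_nonneg) auto
    finally show "(\<Sum>k<n. norm (a k * z k))\<^sup>2 \<le> ?S * ?Q" .
  qed
  then have "(\<Sum>k. norm (a k * z k)) \<le> sqrt (?S * ?Q)" by (intro suminf_le_const s)
  then have "norm (\<Sum>k. a k * z k) \<le> sqrt (?S * ?Q)" using summable_norm[OF s] by linarith
  then have "(norm (\<Sum>k. a k * z k))\<^sup>2 \<le> (sqrt (?S * ?Q))\<^sup>2" by (rule power_mono) simp
  then show "(norm (\<Sum>k. a k * z k))\<^sup>2 \<le> ?S * ?Q" using SQ by simp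
qed

text \<open>The uniform bound \<open>K\<close> makes the integral of the sum of |a_k| |f_k|^2
  finite. That sum is therefore finite almost everywhere, and by the weighted Cauchy-Schwarz
  inequality it dominates both the convergence of the series and the square of its value.\<close>

lemma L2_weighted_series:
  fixes a :: "nat \<Rightarrow> complex" and f :: "nat \<Rightarrow> real \<Rightarrow> complex"
  assumes a: "summable (\<lambda>k. norm (a k))" and f: "\<And>k. L2 (f k)" and K: "\<And>k. L2norm_sq (f k) \<le> K"
  shows "AE x in lborel. summable (\<lambda>k. norm (a k * f k x))" "L2 (\<lambda>x. \<Sum>k. a k * f k x)"
proof -
  note [measurable] = L2_measurable[OF f]
  let ?h = "\<lambda>k x. norm (a k) * (norm (f k x))\<^sup>2"
  have i: "integrable lborel (?h k)" for k using L2_integrable[OF f] by simp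
  have int: "(LINT x|lborel. ?h k x) = norm (a k) * L2norm_sq (f k)" for k by (simp add: L2norm_sq_def)
  have s: "summable (\<lambda>k. LINT x|lborel. ?h k x)" unfolding int
    by (rule summable_comparison_test'[OF summable_mult2[OF a, of K], of 0])
       (use K in \<open>simp add: mult_left_mono\<close>)
  have AE: "AE x in lborel. summable (\<lambda>k. ?h k x)"
    by (rule AE_summable_of_summable_integrals[OF i _ s]) simp
  then show "AE x in lborel. summable (\<lambda>k. norm (a k * f k x))"
    by eventually_elim (rule suminf_Cauchy_Schwarz(1)[OF a])
  show "L2 (\<lambda>x. \<Sum>k. a k * f k x)"
  proof (rule L2_bound_AE)
    show "(\<lambda>x. \<Sum>k. a k * f k x) \<in> borel_measurable borel" by measurable
    have "integrable lborel (\<lambda>x. \<Sum>k. ?h k x)"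
      by (rule integrable_suminf[OF i _]) (use AE s in simp_all)
    then show "integrable lborel (\<lambda>x. (\<Sum>k. norm (a k)) * (\<Sum>k. ?h k x))" by simp
    show "AE x in lborel. (norm (\<Sum>k. a k * f k x))\<^sup>2 \<le> (\<Sum>k. norm (a k)) * (\<Sum>k. ?h k x)"
      using AE by eventually_elim (rule suminf_Cauchy_Schwarz(2)[OF a])
  qed
qed

text \<open>On the interval |f| <= |f|^2 + 1. The resulting L^1 bound depends on the length
  \<open>u\<close> but not on the position \<open>A\<close>, so it is uniform over intervals that
  move with k.\<close>

lemma integrable_mult_indicator_L2:
  assumes f: "L2 f" and [measurable]: "e \<in> borel_measurable borel" and e: "\<And>x. norm (e x) \<le> 1"
    and zero: "\<And>x. x \<notin> {A..A + u} \<Longrightarrow> f x = 0" and u: "u \<ge> 0"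
  shows "integrable lborel (\<lambda>x. f x * e x)"
    "(LINT x|lborel. norm (f x * e x)) \<le> L2norm_sq f + u"
proof -
  note [measurable] = L2_measurable[OF f]
  have ind: "integrable lborel (\<lambda>x. indicator {A..A + u} x :: real)"
    using u by (intro integrable_real_indicator) (auto simp: emeasure_lborel_Icc_eq)
  have h: "integrable lborel (\<lambda>x. (norm (f x))\<^sup>2 + indicator {A..A + u} x)"
    using L2_integrable[OF f] ind by simp
  have le: "norm (f x * e x) \<le> (norm (f x))\<^sup>2 + indicator {A..A + u} x" for x
  proof (cases "x \<in> {A..A + u}")
    case True
    have "norm (f x) \<le> (norm (f x))\<^sup>2 + 1"
      using sum_squares_bound[of "norm (f x)" 1] norm_ge_zero[of "f x"] unfolding power_one by linarith
    moreover have "norm (f x * e x) \<le> norm (f x)"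
      unfolding norm_mult by (rule mult_left_le) (simp_all add: e)
    ultimately show ?thesis using True by simp
  qed (simp add: zero)
  show i: "integrable lborel (\<lambda>x. f x * e x)"
    by (rule Bochner_Integration.integrable_bound[OF h])
       (use le in \<open>auto intro!: AE_I2 order_trans[OF le] simp: abs_if\<close>)
  have "(LINT x|lborel. norm (f x * e x)) \<le> (LINT x|lborel. (norm (f x))\<^sup>2 + indicator {A..A + u} x)"
    by (rule integral_mono[OF integrable_norm[OF i] h le])
  also have "\<dots> = L2norm_sq f + u"
    using L2_integrable[OF f] ind u by (simp add: L2norm_sq_def)
  finally show "(LINT x|lborel. norm (f x * e x)) \<le> L2norm_sq f + u" .
qed

text \<open>Needed for two families: pulses, supported near the moving points b_k, and their folded
  versions, all supported in (0, u). Hence the start \<open>A k\<close> may vary while the length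
  \<open>u\<close> is common; the L^1 norms are then at most K + u.\<close>

lemma integral_weighted_series:
  fixes a :: "nat \<Rightarrow> complex" and f :: "nat \<Rightarrow> real \<Rightarrow> complex"
  assumes a: "summable (\<lambda>k. norm (a k))" and f: "\<And>k. L2 (f k)" and K: "\<And>k. L2norm_sq (f k) \<le> K"
    and e[measurable]: "e \<in> borel_measurable borel" and e1: "\<And>x. norm (e x) \<le> 1"
    and zero: "\<And>k x. x \<notin> {A k..A k + u} \<Longrightarrow> f k x = 0" and u: "u \<ge> 0"
  shows "(LINT x|lborel. (\<Sum>k. a k * f k x) * e x) = (\<Sum>k. a k * (LINT x|lborel. f k x * e x))"
proof -
  note [measurable] = L2_measurable[OF f]
  note I = integrable_mult_indicator_L2[OF f e e1 zero u]
  have i: "integrable lborel (\<lambda>x. a k * (f k x * e x))" for k using I(1) by simp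
  have AE: "AE x in lborel. summable (\<lambda>k. norm (a k * f k x))" by (rule L2_weighted_series(1)[OF a f K])
  have "AE x in lborel. (\<Sum>k. a k * f k x) * e x = (\<Sum>k. a k * (f k x * e x))"
    using AE
  proof eventually_elim
    case (elim x)
    from suminf_mult2[OF summable_norm_cancel[OF elim], of "e x"] show ?case by (simp add: mult.assoc)
  qed
  then have "(LINT x|lborel. (\<Sum>k. a k * f k x) * e x) = (LINT x|lborel. (\<Sum>k. a k * (f k x * e x)))"
    by (intro integral_cong_AE) measurable
  also have "\<dots> = (\<Sum>k. LINT x|lborel. a k * (f k x * e x))"
  proof (rule integral_suminf[OF i])
    show "AE x in lborel. summable (\<lambda>k. norm (a k * (f k x * e x)))"
      using AE
    proof eventually_elim
      case (elim x)
      have "summable (\<lambda>k. norm (a k * f k x) * norm (e x))" by (rule summable_mult2[OF elim])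
      then show ?case by (simp add: norm_mult mult.assoc)
    qed
    show "summable (\<lambda>k. LINT x|lborel. norm (a k * (f k x * e x)))"
    proof (rule summable_comparison_test'[OF summable_mult2[OF a, of "K + u"], of 0])
      show "norm (LINT x|lborel. norm (a k * (f k x * e x))) \<le> norm (a k) * (K + u)" for k
      proof -
        have "(LINT x|lborel. norm (a k * (f k x * e x))) = norm (a k) * (LINT x|lborel. norm (f k x * e x))"
          by (simp add: norm_mult)
        moreover have "\<dots> \<le> norm (a k) * (K + u)"
        proof (rule mult_left_mono)
          have "(LINT x|lborel. norm (f k x * e x)) \<le> L2norm_sq (f k) + u" by (rule I(2))
          then show "(LINT x|lborel. norm (f k x * e x)) \<le> K + u" using K[of k] by linarith
        qed simp
        ultimately show ?thesis by (simp add: integral_nonneg_AE)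
      qed
    qed
  qed
  finally show ?thesis by simp
qed

section \<open>Pulses and their folding by cyclic shifts\<close>

lemma integral_shift: "(LINT x|lborel. f (x + c)) = (LINT x|lborel. f x)" for f :: "real \<Rightarrow> complex"
  using lborel_integral_real_affine[of 1 f c] by (simp add: add.commute)

lemma integrable_shift: "integrable lborel f \<Longrightarrow> integrable lborel (\<lambda>x. f (x + c))" for f :: "real \<Rightarrow> complex"
  using lborel_integrable_real_affine[of f 1 c] by (simp add: add.commute)

lemma AE_lborel_neq: "AE x in lborel. x \<noteq> (c::real)"
proof -
  have "{c} \<in> null_sets lborel" by (auto intro: null_setsI)
  from AE_not_in[OF this] show ?thesis by simp
qed

definition pulse :: "real \<Rightarrow> real \<Rightarrow> real \<Rightarrow> real \<Rightarrow> real" where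
  "pulse \<alpha> w \<beta> x = (if \<beta> < x \<and> x \<le> \<beta> + 1 / \<alpha> then exp (2 * pi * w * (x - \<beta>)) else 0)"

text \<open>The k-th term on one period, with the weight exp(2 pi w t) included. The end points are
  left out so that the function vanishes off the open interval, as \<open>Fourier_Parseval\<close>
  requires; this changes it on a null set only.\<close>

definition segment :: "real \<Rightarrow> real \<Rightarrow> (real \<Rightarrow> complex) \<Rightarrow> real \<Rightarrow> real \<Rightarrow> real \<Rightarrow> complex" where
  "segment \<alpha> w G m \<beta> t = (if 0 < t \<and> t < 1 / \<alpha>
     then complex_of_real (exp (2 * pi * w * t)) * A_op \<alpha> w \<beta> (\<lambda>s. G (s + m + \<beta>)) t else 0)"

lemma pulse_measurable [measurable]: "pulse \<alpha> w \<beta> \<in> borel_measurable borel"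
  unfolding pulse_def by measurable

lemma pulse_bounds: "w < 0 \<Longrightarrow> 0 \<le> pulse \<alpha> w \<beta> x" "w < 0 \<Longrightarrow> pulse \<alpha> w \<beta> x \<le> 1"
  by (auto simp: pulse_def mult_le_0_iff)

text \<open>The factor exp(2 pi w/\<alpha>) is exactly the decay over one period, so beyond \<beta>
  + 1/\<alpha> the two exponentials cancel.\<close>

lemma decay_minus_shifted:
  assumes "\<alpha> > 0"
  shows "decay w \<beta> x - exp (2 * pi * w / \<alpha>) * decay w \<beta> (x - 1 / \<alpha>) = pulse \<alpha> w \<beta> x"
proof -
  have "exp (2 * pi * w / \<alpha>) * exp (2 * pi * w * (x - 1 / \<alpha> - \<beta>)) = exp (2 * pi * w * (x - \<beta>))"
    unfolding exp_add[symmetric] by (simp add: algebra_simps)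
  moreover have "\<beta> < x" if "\<beta> < x - 1 / \<alpha>"
  proof -
    have "0 < 1 / \<alpha>" using assms by simp
    then show ?thesis using that by linarith
  qed
  ultimately show ?thesis by (auto simp: decay_def pulse_def)
qed

lemma bstar_bounds:
  assumes "\<alpha> > 0"
  shows "0 \<le> bstar \<alpha> \<beta>" "bstar \<alpha> \<beta> < 1 / \<alpha>"
proof -
  have "bstar \<alpha> \<beta> = (\<beta> * \<alpha> - real_of_int \<lfloor>\<beta> * \<alpha>\<rfloor>) / \<alpha>"
    using assms by (simp add: bstar_def diff_divide_distrib)
  moreover have "0 \<le> \<beta> * \<alpha> - real_of_int \<lfloor>\<beta> * \<alpha>\<rfloor>" "\<beta> * \<alpha> - real_of_int \<lfloor>\<beta> * \<alpha>\<rfloor> < 1" by linarith+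
  ultimately show "0 \<le> bstar \<alpha> \<beta>" "bstar \<alpha> \<beta> < 1 / \<alpha>"
    using assms by (auto intro: divide_strict_right_mono)
qed

text \<open>Write \<beta> = bs + N with N a multiple of u = 1/\<alpha>. For t in (bs, u) the point t
  + N lies in (\<beta>, N + u); for t in (0, bs] the point t + N + u lies in (N + u, \<beta> + u].
  On each branch exp(2 pi w t) times the exponential in \<open>A_op\<close> is the pulse at that
  point, so the operator A_k is the folding of one pulse interval.\<close>

lemma segment_eq:
  fixes \<alpha> \<beta> :: real
  defines "N \<equiv> real_of_int \<lfloor>\<beta> * \<alpha>\<rfloor> / \<alpha>" and "bs \<equiv> bstar \<alpha> \<beta>"
  assumes \<alpha>: "\<alpha> > 0"
  shows "segment \<alpha> w G m \<beta> t =
    (if bs < t \<and> t < 1 / \<alpha> then complex_of_real (pulse \<alpha> w \<beta> (t + N)) * G (t + N + m) else 0) +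
    (if 0 < t \<and> t \<le> bs then complex_of_real (pulse \<alpha> w \<beta> (t + (N + 1 / \<alpha>))) * G (t + (N + 1 / \<alpha>) + m) else 0)"
proof -
  have \<beta>: "\<beta> = bs + N" by (simp add: bs_def N_def bstar_def)
  have bs: "0 \<le> bs" "bs < 1 / \<alpha>" unfolding bs_def by (rule bstar_bounds[OF \<alpha>])+
  consider "t \<le> 0 \<or> 1 / \<alpha> \<le> t" | "0 < t" "t \<le> bs" | "bs < t" "t < 1 / \<alpha>" by linarith
  then show ?thesis
  proof cases
    case 1
    then show ?thesis using bs by (auto simp: segment_def)
  next
    case 2
    have "exp (2 * pi * w * t) * exp (- 2 * pi * w * (bs - 1 / \<alpha>)) = exp (2 * pi * w * (t + (N + 1 / \<alpha>) - \<beta>))"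
      unfolding exp_add[symmetric] \<beta> by (simp add: algebra_simps)
    then have "complex_of_real (exp (2 * pi * w * t)) * complex_of_real (exp (- 2 * pi * w * (bs - 1 / \<alpha>))) =
        complex_of_real (pulse \<alpha> w \<beta> (t + (N + 1 / \<alpha>)))"
      unfolding of_real_mult[symmetric] using 2 bs \<beta> by (simp add: pulse_def)
    moreover have "G (t - bs + 1 / \<alpha> + m + \<beta>) = G (t + (N + 1 / \<alpha>) + m)"
      by (rule arg_cong[of _ _ G]) (simp add: \<beta>)
    ultimately show ?thesis
      using 2 bs by (simp add: segment_def A_op_def Let_def bs_def[symmetric] mult.assoc[symmetric] del: of_real_mult)
  next
    case 3
    have "exp (2 * pi * w * t) * exp (- 2 * pi * w * bs) = exp (2 * pi * w * (t + N - \<beta>))"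
      unfolding exp_add[symmetric] \<beta> by (simp add: algebra_simps)
    then have "complex_of_real (exp (2 * pi * w * t)) * complex_of_real (exp (- 2 * pi * w * bs)) =
        complex_of_real (pulse \<alpha> w \<beta> (t + N))"
      unfolding of_real_mult[symmetric] using 3 bs \<beta> by (simp add: pulse_def)
    moreover have "G (t - bs + m + \<beta>) = G (t + N + m)"
      by (rule arg_cong[of _ _ G]) (simp add: \<beta>)
    ultimately show ?thesis
      using 3 bs by (simp add: segment_def A_op_def Let_def bs_def[symmetric] mult.assoc[symmetric] del: of_real_mult)
  qed
qed

text \<open>The bound is independent of \<beta> and \<open>m\<close>; this uniformity feeds the
  constant \<open>K\<close> of the series lemmas. Each of the two pieces is dominated by one
  translate of \<open>G\<close>, whence the factor 2.\<close>

lemma segment_L2: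
  assumes \<alpha>: "\<alpha> > 0" and w: "w < 0" and G: "L2 G"
  shows "L2 (segment \<alpha> w G m \<beta>)" "L2norm_sq (segment \<alpha> w G m \<beta>) \<le> 2 * L2norm_sq G"
proof -
  note [measurable] = L2_measurable[OF G]
  let ?N = "real_of_int \<lfloor>\<beta> * \<alpha>\<rfloor> / \<alpha>"
  let ?c = "?N + m" and ?d = "?N + 1 / \<alpha> + m"
  have m: "segment \<alpha> w G m \<beta> \<in> borel_measurable borel"
    unfolding segment_eq[OF \<alpha>, abs_def] by measurable
  have i: "integrable lborel (\<lambda>t. (norm (G (t + ?c)))\<^sup>2 + (norm (G (t + ?d)))\<^sup>2)"
    using L2_integrable[OF L2_shift(1)[OF G]] by simp
  have le: "norm (complex_of_real (pulse \<alpha> w \<beta> x) * z) \<le> norm z" for x z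
    using pulse_bounds[OF w, of \<alpha> \<beta> x] by (simp add: norm_mult mult_left_le_one_le)
  have "(norm (segment \<alpha> w G m \<beta> t))\<^sup>2 \<le> (norm (G (t + ?c)))\<^sup>2 + (norm (G (t + ?d)))\<^sup>2" for t
    using power_mono[OF le[of "t + ?N" "G (t + ?c)"] norm_ge_zero, of 2]
      power_mono[OF le[of "t + (?N + 1 / \<alpha>)" "G (t + ?d)"] norm_ge_zero, of 2]
    unfolding segment_eq[OF \<alpha>] by (auto simp: add.assoc intro: add_increasing add_increasing2)
  note B = L2_bound[OF m i this]
  show "L2 (segment \<alpha> w G m \<beta>)" by (rule B(1))
  have "(LINT t|lborel. (norm (G (t + ?c)))\<^sup>2 + (norm (G (t + ?d)))\<^sup>2) =
      L2norm_sq (\<lambda>t. G (t + ?c)) + L2norm_sq (\<lambda>t. G (t + ?d))"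
    unfolding L2norm_sq_def
    by (rule Bochner_Integration.integral_add) (rule L2_integrable[OF L2_shift(1)[OF G]])+
  then show "L2norm_sq (segment \<alpha> w G m \<beta>) \<le> 2 * L2norm_sq G"
    using B(2) by (simp only: L2_shift(2)[OF G])
qed

lemma pulse_L2:
  assumes w: "w < 0" and G: "L2 G"
  shows "L2 (\<lambda>x. complex_of_real (pulse \<alpha> w \<beta> x) * G (x + m))"
    "L2norm_sq (\<lambda>x. complex_of_real (pulse \<alpha> w \<beta> x) * G (x + m)) \<le> L2norm_sq G"
  using L2_mult_bounded[OF L2_shift(1)[OF G], of "\<lambda>x. complex_of_real (pulse \<alpha> w \<beta> x)" 1 m]
    pulse_bounds[OF w] by (simp_all add: L2_shift(2)[OF G])

text \<open>The two pieces of the pulse interval are moved by multiples of 1/\<alpha>, which the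
  periodic \<open>e\<close> does not see.\<close>

lemma integral_segment:
  assumes \<alpha>: "\<alpha> > 0" and w: "w < 0" and G: "L2 G"
    and e[measurable]: "e \<in> borel_measurable borel" and e1: "\<And>x. norm (e x) \<le> 1"
    and per: "\<And>x j. e (x + real_of_int j / \<alpha>) = e x"
  shows "(LINT t|lborel. segment \<alpha> w G m \<beta> t * e t) =
    (LINT x|lborel. complex_of_real (pulse \<alpha> w \<beta> x) * G (x + m) * e x)"
proof -
  note [measurable] = L2_measurable[OF G]
  define N where "N = real_of_int \<lfloor>\<beta> * \<alpha>\<rfloor> / \<alpha>"
  define bs where "bs = bstar \<alpha> \<beta>"
  have \<beta>: "\<beta> = bs + N" by (simp add: bs_def N_def bstar_def)
  have bs: "0 \<le> bs" "bs < 1 / \<alpha>" unfolding bs_def by (rule bstar_bounds[OF \<alpha>])+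
  define v where "v x = complex_of_real (pulse \<alpha> w \<beta> x) * G (x + m) * e x" for x
  have [measurable]: "v \<in> borel_measurable borel" unfolding v_def by measurable
  have iv: "integrable lborel v"
    unfolding v_def
    by (rule integrable_mult_indicator_L2(1)[OF pulse_L2(1)[OF w G] e e1, of \<beta> "1 / \<alpha>"])
       (use \<alpha> in \<open>auto simp: pulse_def\<close>)
  define v1 where "v1 x = indicator {bs<..<1 / \<alpha>} (x - N) *\<^sub>R v x" for x
  define v2 where "v2 x = indicator {0<..bs} (x - (N + 1 / \<alpha>)) *\<^sub>R v x" for x
  have [measurable]: "v1 \<in> borel_measurable borel" "v2 \<in> borel_measurable borel"
    unfolding v1_def v2_def by measurable
  have i: "integrable lborel v1" "integrable lborel v2"
    by (rule Bochner_Integration.integrable_bound[OF iv], measurable,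
        auto simp: v1_def v2_def indicator_def)+
  have per1: "e (t + N) = e t" "e (t + (N + 1 / \<alpha>)) = e t" for t
  proof -
    show "e (t + N) = e t" using per[of t "\<lfloor>\<beta> * \<alpha>\<rfloor>"] by (simp add: N_def)
    have "N + 1 / \<alpha> = real_of_int (\<lfloor>\<beta> * \<alpha>\<rfloor> + 1) / \<alpha>" by (simp add: N_def add_divide_distrib)
    then show "e (t + (N + 1 / \<alpha>)) = e t" by (simp only: per)
  qed
  have "segment \<alpha> w G m \<beta> t * e t = v1 (t + N) + v2 (t + (N + 1 / \<alpha>))" for t
    unfolding segment_eq[OF \<alpha>] v1_def v2_def v_def per1 N_def[symmetric] bs_def[symmetric]
    by (simp add: indicator_def distrib_right)
  then have "(LINT t|lborel. segment \<alpha> w G m \<beta> t * e t) = (LINT t|lborel. v1 (t + N) + v2 (t + (N + 1 / \<alpha>)))"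
    by simp
  also have "\<dots> = (LINT t|lborel. v1 (t + N)) + (LINT t|lborel. v2 (t + (N + 1 / \<alpha>)))"
    by (intro Bochner_Integration.integral_add integrable_shift i)
  also have "\<dots> = (LINT x|lborel. v1 x + v2 x)"
    unfolding integral_shift by (rule Bochner_Integration.integral_add[OF i, symmetric])
  also have "\<dots> = (LINT x|lborel. v x)"
  proof (rule integral_cong_AE)
    \<comment> \<open>The cut point N + 1/\<alpha> belongs to neither piece, hence equality only
      almost everywhere.\<close>
    show "AE x in lborel. v1 x + v2 x = v x"
      using AE_lborel_neq[of "N + 1 / \<alpha>"]
    proof eventually_elim
      case (elim x)
      show ?case
      proof (cases "\<beta> < x \<and> x \<le> \<beta> + 1 / \<alpha>")
        case True
        then show ?thesis using elim bs unfolding v1_def v2_def \<beta>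
          by (cases "x < N + 1 / \<alpha>") (auto simp: indicator_def)
      next
        case False
        then have "v x = 0" by (auto simp: v_def pulse_def)
        then show ?thesis by (simp add: v1_def v2_def)
      qed
    qed
  qed measurable
  finally show ?thesis by (simp add: v_def)
qed

section \<open>The frame coefficients\<close>

context rational_window
begin

definition q :: real where "q = exp (2 * pi * w / \<alpha>)"

text \<open>The conjugate makes the conjugated frame coefficient linear in \<open>G\<close>, as the
  operators A_k are. The translation by +1/\<alpha> becomes one by -1/\<alpha> on
  \<open>profile\<close> after a change of variable.\<close>

definition test_fun :: "(real \<Rightarrow> complex) \<Rightarrow> real \<Rightarrow> complex" where
  "test_fun G x = cnj (G x - complex_of_real q * G (x + 1 / \<alpha>))"

text \<open>The folded function whose Fourier coefficients on (0, 1/\<alpha>) are the frame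
  coefficients. The series is pointwise and is known to converge for almost every t.\<close>

definition synthesis :: "(real \<Rightarrow> complex) \<Rightarrow> int \<Rightarrow> real \<Rightarrow> complex" where
  "synthesis G m t = (\<Sum>k. a k * segment \<alpha> w G (real_of_int m) (b k) t)"

definition shift_sum :: "(real \<Rightarrow> complex) \<Rightarrow> ennreal" where
  "shift_sum G = (\<integral>\<^sup>+ m. (\<integral>\<^sup>+ t\<in>{0..1/\<alpha>}.
     ennreal ((norm (\<Sum>k. a k * A_op \<alpha> w (b k) (\<lambda>s. G (s + real_of_int m + b k)) t))\<^sup>2) \<partial>lborel)
   \<partial>count_space (UNIV :: int set))"

lemma q_bounds: "0 < q" "q < 1"
  using \<alpha> w by (auto simp: q_def divide_neg_pos mult_pos_neg)

lemma profile_minus_shifted: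
  "profile x - complex_of_real q * profile (x - 1 / \<alpha>) = (\<Sum>k. a k * complex_of_real (pulse \<alpha> w (b k) x))"
proof -
  have s: "summable (\<lambda>k. a k * complex_of_real (decay w (b k) y))" for y
    by (rule summable_mult_bounded(2)[of _ 1]) (use decay_bounds[OF w] in simp)
  have "profile x - complex_of_real q * profile (x - 1 / \<alpha>) =
      (\<Sum>k. a k * complex_of_real (decay w (b k) x) - complex_of_real q * (a k * complex_of_real (decay w (b k) (x - 1 / \<alpha>))))"
    unfolding profile_def suminf_mult[OF s, symmetric] by (intro suminf_diff s summable_mult)
  also have "\<dots> = (\<Sum>k. a k * complex_of_real (pulse \<alpha> w (b k) x))"
    unfolding decay_minus_shifted[OF \<alpha>, symmetric] q_def by (simp add: algebra_simps)
  finally show ?thesis .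
qed

lemma synthesis_L2:
  assumes G: "L2 G"
  shows "L2 (synthesis G m)" "AE t in lborel. summable (\<lambda>k. norm (a k * segment \<alpha> w G (real_of_int m) (b k) t))"
  unfolding synthesis_def[abs_def]
  by (rule L2_weighted_series[OF a segment_L2[OF \<alpha> w G]])+

lemma synthesis_outside: "t \<notin> {0<..<1 / \<alpha>} \<Longrightarrow> synthesis G m t = 0"
  by (auto simp: synthesis_def segment_def)

text \<open>Only moduli are compared: the identity proved inside is for the conjugate coefficient
  and carries the constant -2 pi i.\<close>

lemma L2inner_test_fun_gabor_hat:
  assumes G: "L2 G"
  shows "norm (L2inner (test_fun G) (gabor_hat m n)) =
    2 * pi * norm (L2inner (synthesis G m) (fourier_exp (1 / \<alpha>) n))"
proof -
  define e where "e x = cis (- (2 * pi * \<alpha> * real_of_int n * x))" for x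
  have [measurable]: "e \<in> borel_measurable borel" unfolding e_def by measurable
  have e1: "norm (e x) \<le> 1" for x by (simp add: e_def)
  have per: "e (x + real_of_int j / \<alpha>) = e x" for x j
  proof -
    have "- (2 * pi * \<alpha> * real_of_int n * (x + real_of_int j / \<alpha>)) =
        - (2 * pi * \<alpha> * real_of_int n * x) + 2 * pi * real_of_int (- n * j)"
      using \<alpha> by (simp add: field_simps)
    moreover have "cis (2 * pi * real_of_int (- n * j)) = 1" by (rule cis_multiple_2pi) simp
    ultimately show ?thesis unfolding e_def by (simp only: cis_mult[symmetric] mult_1_right)
  qed
  note [measurable] = L2_measurable[OF G]
  let ?M = "real_of_int m" and ?u = "1 / \<alpha>"
  have profile_L2: "L2 profile"
    by (rule L2_bounded_integrable[OF profile_integrable profile_bounded])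
  \<comment> \<open>Each product is integrable as a product of two L^2 functions, which permits
    splitting and rejoining the difference below.\<close>
  have pi_int: "integrable lborel (\<lambda>x. G (x + c) * (profile (x + d) * e x))" for c d
  proof -
    have "L2 (\<lambda>x. cnj (e x * profile (x + d)))"
      by (intro L2_cnj L2_mult_bounded(1)[of _ _ 1] L2_shift profile_L2 e1) measurable
    from L2_inner_integrable[OF L2_shift(1)[OF G] this] show ?thesis by (simp add: mult_ac)
  qed
  have "cnj (L2inner (test_fun G) (gabor_hat m n)) =
      (LINT x|lborel. cnj (test_fun G x * cnj (gabor_hat m n x)))"
    unfolding L2inner_def by (rule Bochner_Integration.integral_cnj[symmetric])
  also have "\<dots> = (LINT x|lborel. (- 2 * pi * \<i>) * ((G x - complex_of_real q * G (x + ?u)) * (profile (x - ?M) * e (x - ?M))))"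
    unfolding test_fun_def gabor_hat_def e_def
    by (rule Bochner_Integration.integral_cong[OF refl]) (simp only: complex_cnj_mult complex_cnj_cnj mult_ac)
  also have "\<dots> = (- 2 * pi * \<i>) * (LINT x|lborel. (G x - complex_of_real q * G (x + ?u)) * (profile (x - ?M) * e (x - ?M)))"
    by (rule integral_mult_right_zero)
  also have "(LINT x|lborel. (G x - complex_of_real q * G (x + ?u)) * (profile (x - ?M) * e (x - ?M))) =
      (LINT x|lborel. (G (x + ?M) - complex_of_real q * G (x + ?M + ?u)) * (profile (x + ?M - ?M) * e (x + ?M - ?M)))"
    by (rule integral_shift[symmetric])
  also have "\<dots> = (LINT x|lborel. G (x + ?M) * (profile (x + 0) * e x) - complex_of_real q * (G (x + (?M + ?u)) * (profile (x + 0) * e x)))"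
    by (simp add: left_diff_distrib mult.assoc add.assoc)
  also have "\<dots> = (LINT x|lborel. G (x + ?M) * (profile (x + 0) * e x)) -
      complex_of_real q * (LINT x|lborel. G (x + (?M + ?u)) * (profile (x + 0) * e x))"
    by (subst Bochner_Integration.integral_diff) (simp_all only: pi_int integrable_mult_right integral_mult_right_zero)
  \<comment> \<open>Substituting x - 1/\<alpha> takes the shift off \<open>G\<close> and puts it on
    \<open>profile\<close>; \<open>e\<close> is unchanged because 1/\<alpha> is a period.\<close>
  also have "(LINT x|lborel. G (x + (?M + ?u)) * (profile (x + 0) * e x)) =
      (LINT x|lborel. G (x + - ?u + (?M + ?u)) * (profile (x + - ?u + 0) * e (x + - ?u)))"
    by (rule integral_shift[symmetric])
  also have "\<dots> = (LINT x|lborel. G (x + ?M) * (profile (x + - ?u) * e x))"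
    using per[of _ "- 1"] by (simp add: algebra_simps)
  also have "(LINT x|lborel. G (x + ?M) * (profile (x + 0) * e x)) -
      complex_of_real q * (LINT x|lborel. G (x + ?M) * (profile (x + - ?u) * e x)) =
      (LINT x|lborel. G (x + ?M) * (profile (x + 0) * e x) - complex_of_real q * (G (x + ?M) * (profile (x + - ?u) * e x)))"
    by (subst Bochner_Integration.integral_diff) (simp_all only: pi_int integrable_mult_right integral_mult_right_zero)
  also have "\<dots> = (LINT x|lborel. (\<Sum>k. a k * (complex_of_real (pulse \<alpha> w (b k) x) * G (x + ?M))) * e x)"
  proof (rule Bochner_Integration.integral_cong[OF refl])
    fix x
    have s: "summable (\<lambda>k. a k * complex_of_real (pulse \<alpha> w (b k) x))"
      by (rule summable_mult_bounded(2)[of _ 1]) (use pulse_bounds[OF w] in simp)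
    have "(\<Sum>k. a k * (complex_of_real (pulse \<alpha> w (b k) x) * G (x + ?M))) =
        (\<Sum>k. a k * complex_of_real (pulse \<alpha> w (b k) x)) * G (x + ?M)"
      unfolding suminf_mult2[OF s] by (simp add: mult.assoc)
    moreover have "G (x + ?M) * (profile (x + 0) * e x) - complex_of_real q * (G (x + ?M) * (profile (x + - ?u) * e x)) =
        (profile x - complex_of_real q * profile (x - ?u)) * G (x + ?M) * e x"
      by (simp add: algebra_simps)
    ultimately show "G (x + ?M) * (profile (x + 0) * e x) - complex_of_real q * (G (x + ?M) * (profile (x + - ?u) * e x)) =
        (\<Sum>k. a k * (complex_of_real (pulse \<alpha> w (b k) x) * G (x + ?M))) * e x"
      by (simp only: profile_minus_shifted)
  qed
  \<comment> \<open>The folding depends on b_k, so it acts on single terms only: the series is taken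
    out of the integral here, folded termwise, and put back afterwards.\<close>
  also have "\<dots> = (\<Sum>k. a k * (LINT x|lborel. complex_of_real (pulse \<alpha> w (b k) x) * G (x + ?M) * e x))"
    by (rule integral_weighted_series[OF a pulse_L2[OF w G], where A=b and u="1 / \<alpha>"])
       (use e1 \<alpha> in \<open>auto simp: pulse_def\<close>)
  also have "\<dots> = (\<Sum>k. a k * (LINT t|lborel. segment \<alpha> w G ?M (b k) t * e t))"
    by (simp only: integral_segment[OF \<alpha> w G \<open>e \<in> borel_measurable borel\<close> e1 per])
  also have "\<dots> = (LINT t|lborel. synthesis G m t * e t)"
    unfolding synthesis_def
    by (rule integral_weighted_series[OF a segment_L2[OF \<alpha> w G], where A="\<lambda>_. 0" and u="1 / \<alpha>", symmetric])
       (use e1 \<alpha> in \<open>auto simp: segment_def\<close>)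
  also have "\<dots> = L2inner (synthesis G m) (fourier_exp (1 / \<alpha>) n)"
    unfolding L2inner_def
  proof (rule Bochner_Integration.integral_cong[OF refl])
    fix t
    show "synthesis G m t * e t = synthesis G m t * cnj (fourier_exp (1 / \<alpha>) n t)"
    proof (cases "t \<in> {0<..<1 / \<alpha>}")
      case True
      then have "fourier_exp (1 / \<alpha>) n t = cis (2 * pi * \<alpha> * real_of_int n * t)"
        by (simp add: fourier_exp_def mult_ac)
      then show ?thesis by (simp add: e_def cis_cnj)
    qed (simp add: synthesis_outside)
  qed
  finally have "norm (cnj (L2inner (test_fun G) (gabor_hat m n))) =
      norm ((- 2 * pi * \<i>) * L2inner (synthesis G m) (fourier_exp (1 / \<alpha>) n))" by simp
  then show ?thesis by (simp add: norm_mult)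
qed

text \<open>Tonelli over the two indices, then Parseval in \<open>n\<close> for each
  \<open>m\<close> with period 1/\<alpha>. The constant 4 pi^2 is the squared modulus of -2 pi
  i.\<close>

lemma frame_sum_test_fun:
  assumes G: "L2 G"
  shows "frame_sum (\<lambda>(m, n). gabor_hat m n) (test_fun G) =
    (\<integral>\<^sup>+ m. ennreal (4 * pi\<^sup>2 / \<alpha> * L2norm_sq (synthesis G m)) \<partial>count_space UNIV)"
proof -
  have "frame_sum (\<lambda>(m, n). gabor_hat m n) (test_fun G) =
      (\<integral>\<^sup>+ m. \<integral>\<^sup>+ n. ennreal ((norm (L2inner (test_fun G) (gabor_hat m n)))\<^sup>2) \<partial>count_space UNIV \<partial>count_space UNIV)"
    unfolding frame_sum_def by (subst nn_integral_fst_count_space[symmetric]) simp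
  also have "\<dots> = (\<integral>\<^sup>+ m. ennreal (4 * pi\<^sup>2 / \<alpha> * L2norm_sq (synthesis G m)) \<partial>count_space UNIV)"
  proof (rule nn_integral_cong)
    fix m
    have "(\<integral>\<^sup>+ n. ennreal ((norm (L2inner (test_fun G) (gabor_hat m n)))\<^sup>2) \<partial>count_space UNIV) =
        (\<integral>\<^sup>+ n. ennreal (4 * pi\<^sup>2) * ennreal ((norm (L2inner (synthesis G m) (fourier_exp (1 / \<alpha>) n)))\<^sup>2) \<partial>count_space UNIV)"
      unfolding L2inner_test_fun_gabor_hat[OF G] by (simp add: power_mult_distrib ennreal_mult'[symmetric])
    also have "\<dots> = ennreal (4 * pi\<^sup>2) * frame_sum (fourier_exp (1 / \<alpha>)) (synthesis G m)"
      unfolding frame_sum_def by (rule nn_integral_cmult) simp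
    also have "frame_sum (fourier_exp (1 / \<alpha>)) (synthesis G m) = ennreal (1 / \<alpha> * L2norm_sq (synthesis G m))"
      by (rule Fourier_Parseval) (use \<alpha> synthesis_L2(1)[OF G] synthesis_outside in auto)
    also have "ennreal (4 * pi\<^sup>2) * ennreal (1 / \<alpha> * L2norm_sq (synthesis G m)) = ennreal (4 * pi\<^sup>2 / \<alpha> * L2norm_sq (synthesis G m))"
      using \<alpha> by (subst ennreal_mult'[symmetric]) (auto simp: mult.assoc)
    finally show "(\<integral>\<^sup>+ n. ennreal ((norm (L2inner (test_fun G) (gabor_hat m n)))\<^sup>2) \<partial>count_space UNIV) =
        ennreal (4 * pi\<^sup>2 / \<alpha> * L2norm_sq (synthesis G m))" .
  qed
  finally show ?thesis .
qed

text \<open>The two integrands differ by the factor exp(4 pi w t), which on (0, 1/\<alpha>) lies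
  between exp(4 pi w/\<alpha>) and 1.\<close>

lemma shift_integral_bounds:
  assumes G: "L2 G"
  defines "R \<equiv> \<lambda>m. (\<integral>\<^sup>+ t\<in>{0..1/\<alpha>}.
     ennreal ((norm (\<Sum>k. a k * A_op \<alpha> w (b k) (\<lambda>s. G (s + real_of_int m + b k)) t))\<^sup>2) \<partial>lborel)"
  shows "ennreal (L2norm_sq (synthesis G m)) \<le> R m"
    and "R m \<le> ennreal (exp (- 4 * pi * w / \<alpha>) * L2norm_sq (synthesis G m))"
proof -
  note [measurable] = L2_measurable[OF synthesis_L2(1)[OF G]]
  let ?A = "\<lambda>t. \<Sum>k. a k * A_op \<alpha> w (b k) (\<lambda>s. G (s + real_of_int m + b k)) t"
  let ?E = "exp (- 4 * pi * w / \<alpha>)"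
  have norm_eq: "ennreal (L2norm_sq (synthesis G m)) = (\<integral>\<^sup>+ t. ennreal ((norm (synthesis G m t))\<^sup>2) \<partial>lborel)"
    unfolding L2norm_sq_def by (rule nn_integral_eq_integral[symmetric]) (use L2_integrable[OF synthesis_L2(1)[OF G]] in auto)
  have AE: "AE t in lborel.
      ennreal ((norm (synthesis G m t))\<^sup>2) \<le> ennreal ((norm (?A t))\<^sup>2) * indicator {0..1 / \<alpha>} t \<and>
      ennreal ((norm (?A t))\<^sup>2) * indicator {0..1 / \<alpha>} t \<le> ennreal (?E * (norm (synthesis G m t))\<^sup>2)"
    using synthesis_L2(2)[OF G, of m] AE_lborel_neq[of 0] AE_lborel_neq[of "1 / \<alpha>"]
  proof eventually_elim
    case (elim t)
    show ?case
    proof (cases "0 < t \<and> t < 1 / \<alpha>")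
      case False
      then have "t \<notin> {0..1 / \<alpha>}" using elim by auto
      then show ?thesis by (auto simp: synthesis_outside)
    next
      case True
      let ?x = "exp (2 * pi * w * t)"
      have seg: "a k * segment \<alpha> w G (real_of_int m) (b k) t =
          complex_of_real ?x * (a k * A_op \<alpha> w (b k) (\<lambda>s. G (s + real_of_int m + b k)) t)" for k
        using True by (simp add: segment_def)
      have "summable (\<lambda>k. complex_of_real ?x * (a k * A_op \<alpha> w (b k) (\<lambda>s. G (s + real_of_int m + b k)) t))"
        using summable_norm_cancel[OF elim(1)] unfolding seg .
      \<comment> \<open>The weight is nonzero, so the series without it converges too; only then can
        the weight be pulled out of the sum.\<close>
      then have s: "summable (\<lambda>k. a k * A_op \<alpha> w (b k) (\<lambda>s. G (s + real_of_int m + b k)) t)"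
        by (subst (asm) summable_cmult_iff) simp
      have syn: "(norm (synthesis G m t))\<^sup>2 = ?x\<^sup>2 * (norm (?A t))\<^sup>2"
        unfolding synthesis_def seg suminf_mult[OF s] by (simp add: norm_mult power_mult_distrib)
      have "2 * pi * w * t \<le> 0" using True w by (simp add: mult_le_0_iff)
      then have "?x\<^sup>2 \<le> 1" by (simp add: power_le_one)
      then have le: "?x\<^sup>2 * (norm (?A t))\<^sup>2 \<le> (norm (?A t))\<^sup>2" by (intro mult_left_le_one_le) auto
      have "1 \<le> ?E * ?x\<^sup>2"
      proof -
        have "?E * ?x\<^sup>2 = exp (- (4 * pi * w) * (1 / \<alpha> - t))"
          by (simp add: exp_double[symmetric] exp_add[symmetric] algebra_simps)
        moreover have "0 \<le> - (4 * pi * w) * (1 / \<alpha> - t)"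
          using True w by (intro mult_nonneg_nonneg) (auto simp: mult_le_0_iff)
        ultimately show ?thesis by simp
      qed
      from mult_right_mono[OF this, of "(norm (?A t))\<^sup>2"]
      have ge: "(norm (?A t))\<^sup>2 \<le> ?E * (?x\<^sup>2 * (norm (?A t))\<^sup>2)" by (simp add: mult.assoc)
      show ?thesis unfolding syn using le ge True by (auto intro!: ennreal_leI)
    qed
  qed
  show "ennreal (L2norm_sq (synthesis G m)) \<le> R m"
    unfolding norm_eq R_def by (rule nn_integral_mono_AE) (use AE in eventually_elim, simp)
  have "R m \<le> (\<integral>\<^sup>+ t. ennreal (?E * (norm (synthesis G m t))\<^sup>2) \<partial>lborel)"
    unfolding R_def by (rule nn_integral_mono_AE) (use AE in eventually_elim, simp)
  also have "\<dots> = (\<integral>\<^sup>+ t. ennreal ?E * ennreal ((norm (synthesis G m t))\<^sup>2) \<partial>lborel)"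
    by (simp add: ennreal_mult')
  also have "\<dots> = ennreal ?E * ennreal (L2norm_sq (synthesis G m))"
    unfolding norm_eq by (rule nn_integral_cmult) measurable
  also have "\<dots> = ennreal (?E * L2norm_sq (synthesis G m))"
    by (rule ennreal_mult'[symmetric]) simp
  finally show "R m \<le> ennreal (?E * L2norm_sq (synthesis G m))" .
qed

lemma frame_sum_le_shift_sum:
  assumes G: "L2 G"
  shows "frame_sum (\<lambda>(m, n). gabor_hat m n) (test_fun G) \<le> ennreal (4 * pi\<^sup>2 / \<alpha>) * shift_sum G"
  unfolding frame_sum_test_fun[OF G] shift_sum_def
proof (subst nn_integral_cmult[symmetric])
  show "(\<integral>\<^sup>+ m. ennreal (4 * pi\<^sup>2 / \<alpha> * L2norm_sq (synthesis G m)) \<partial>count_space UNIV) \<le>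
    (\<integral>\<^sup>+ m. ennreal (4 * pi\<^sup>2 / \<alpha>) * (\<integral>\<^sup>+ t\<in>{0..1/\<alpha>}.
     ennreal ((norm (\<Sum>k. a k * A_op \<alpha> w (b k) (\<lambda>s. G (s + real_of_int m + b k)) t))\<^sup>2) \<partial>lborel) \<partial>count_space UNIV)"
  proof (rule nn_integral_mono)
    fix m
    have "ennreal (4 * pi\<^sup>2 / \<alpha> * L2norm_sq (synthesis G m)) = ennreal (4 * pi\<^sup>2 / \<alpha>) * ennreal (L2norm_sq (synthesis G m))"
      using \<alpha> by (intro ennreal_mult') simp
    then show "ennreal (4 * pi\<^sup>2 / \<alpha> * L2norm_sq (synthesis G m)) \<le> ennreal (4 * pi\<^sup>2 / \<alpha>) * (\<integral>\<^sup>+ t\<in>{0..1/\<alpha>}.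
     ennreal ((norm (\<Sum>k. a k * A_op \<alpha> w (b k) (\<lambda>s. G (s + real_of_int m + b k)) t))\<^sup>2) \<partial>lborel)"
      using mult_left_mono[OF shift_integral_bounds(1)[OF G, of m], of "ennreal (4 * pi\<^sup>2 / \<alpha>)"] by simp
  qed
qed simp

lemma shift_sum_le_frame_sum:
  assumes G: "L2 G"
  shows "shift_sum G \<le> ennreal (exp (- 4 * pi * w / \<alpha>) * \<alpha> / (4 * pi\<^sup>2)) * frame_sum (\<lambda>(m, n). gabor_hat m n) (test_fun G)"
  unfolding frame_sum_test_fun[OF G] shift_sum_def
proof (subst nn_integral_cmult[symmetric])
  let ?E = "exp (- 4 * pi * w / \<alpha>)"
  show "(\<integral>\<^sup>+ m. (\<integral>\<^sup>+ t\<in>{0..1/\<alpha>}.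
     ennreal ((norm (\<Sum>k. a k * A_op \<alpha> w (b k) (\<lambda>s. G (s + real_of_int m + b k)) t))\<^sup>2) \<partial>lborel) \<partial>count_space UNIV) \<le>
    (\<integral>\<^sup>+ m. ennreal (?E * \<alpha> / (4 * pi\<^sup>2)) * ennreal (4 * pi\<^sup>2 / \<alpha> * L2norm_sq (synthesis G m)) \<partial>count_space UNIV)"
  proof (rule nn_integral_mono)
    fix m
    have "ennreal (?E * \<alpha> / (4 * pi\<^sup>2)) * ennreal (4 * pi\<^sup>2 / \<alpha> * L2norm_sq (synthesis G m)) =
        ennreal (?E * L2norm_sq (synthesis G m))"
      using \<alpha> by (subst ennreal_mult'[symmetric]) auto
    then show "(\<integral>\<^sup>+ t\<in>{0..1/\<alpha>}.
       ennreal ((norm (\<Sum>k. a k * A_op \<alpha> w (b k) (\<lambda>s. G (s + real_of_int m + b k)) t))\<^sup>2) \<partial>lborel) \<le>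
      ennreal (?E * \<alpha> / (4 * pi\<^sup>2)) * ennreal (4 * pi\<^sup>2 / \<alpha> * L2norm_sq (synthesis G m))"
      using shift_integral_bounds(2)[OF G, of m] by simp
  qed
qed simp

section \<open>The range of \<open>test_fun\<close> and the conclusion\<close>

lemma test_fun_L2:
  assumes G: "L2 G"
  shows "L2 (test_fun G)" "L2norm_sq (test_fun G) \<le> 4 * L2norm_sq G"
    "(1 - q)\<^sup>2 * L2norm_sq G \<le> L2norm_sq (test_fun G)"
proof -
  let ?F = "\<lambda>x. G x - complex_of_real q * G (x + 1 / \<alpha>)"
  have qG: "L2 (\<lambda>x. complex_of_real q * G (x + 1 / \<alpha>))"
    "L2norm_sq (\<lambda>x. complex_of_real q * G (x + 1 / \<alpha>)) = q\<^sup>2 * L2norm_sq G"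
    using L2_cmult[OF L2_shift(1)[OF G], of "complex_of_real q"] by (simp_all add: L2_shift(2)[OF G])
  have F: "L2 ?F" by (rule L2_diff(1)[OF G qG(1)])
  show "L2 (test_fun G)" unfolding test_fun_def[abs_def] by (rule L2_cnj[OF F])
  have n: "L2norm_sq (test_fun G) = L2norm_sq ?F" unfolding test_fun_def[abs_def] by (rule L2norm_sq_cnj)
  have q2: "q\<^sup>2 \<le> 1" using q_bounds by (simp add: power_le_one)
  show "L2norm_sq (test_fun G) \<le> 4 * L2norm_sq G"
    using L2_diff(2)[OF G qG(1)] mult_right_mono[OF q2 L2norm_sq_nonneg[of G]] unfolding n qG(2) by simp
  \<comment> \<open>Translation preserves the norm, so Cauchy-Schwarz bounds the cross term by 2 q
    |G|^2, and 1 + q^2 - 2 q = (1 - q)^2 > 0 is the lower constant.\<close>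
  have "\<bar>L2norm_sq ?F - (L2norm_sq G + q\<^sup>2 * L2norm_sq G)\<bar> \<le> 2 * (q * L2norm_sq G)"
  proof -
    have "(norm (L2inner G (\<lambda>x. complex_of_real q * G (x + 1 / \<alpha>))))\<^sup>2 \<le> (q * L2norm_sq G)\<^sup>2"
      using L2_Cauchy_Schwarz[OF G qG(1)] unfolding qG(2) by (simp add: power2_eq_square mult_ac)
    then have "norm (L2inner G (\<lambda>x. complex_of_real q * G (x + 1 / \<alpha>))) \<le> q * L2norm_sq G"
      using q_bounds by (subst (asm) power_mono_iff) auto
    then have "\<bar>Re (L2inner G (\<lambda>x. complex_of_real q * G (x + 1 / \<alpha>)))\<bar> \<le> q * L2norm_sq G"
      using abs_Re_le_cmod order_trans by blast
    then show ?thesis unfolding L2norm_sq_diff[OF G qG(1)] qG(2) by simp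
  qed
  then show "(1 - q)\<^sup>2 * L2norm_sq G \<le> L2norm_sq (test_fun G)"
    unfolding n by (simp add: power2_diff algebra_simps)
qed

text \<open>The equation G - q G(. + u) = cnj f is solved approximately by partial sums of the
  Neumann series. The sum telescopes, and the error is q^N times a translate of f, which tends to
  zero because q < 1.\<close>

lemma L2_dense_test_fun: "L2_dense (test_fun ` Collect L2)"
  unfolding L2_dense_def
proof (intro conjI ballI allI impI)
  show "L2 d" if "d \<in> test_fun ` Collect L2" for d using that test_fun_L2(1) by auto
  fix f :: "real \<Rightarrow> complex" and \<epsilon> :: real assume f: "L2 f" and \<epsilon>: "\<epsilon> > 0"
  let ?T = "\<lambda>j x. complex_of_real (q ^ j) * cnj (f (x + real j / \<alpha>))"
  define G where "G N x = (\<Sum>j<N. ?T j x)" for N x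
  have T: "L2 (?T j)" for j by (intro L2_cmult(1) L2_cnj L2_shift(1) f)
  have GL: "L2 (G N)" for N unfolding G_def by (intro L2_sum T) simp
  have step: "complex_of_real q * ?T j (x + 1 / \<alpha>) = ?T (Suc j) x" for j x
    by (simp add: add_divide_distrib add_ac)
  have "G N x - complex_of_real q * G N (x + 1 / \<alpha>) = ?T 0 x - ?T N x" for N x
  proof -
    have "G N x - complex_of_real q * G N (x + 1 / \<alpha>) = (\<Sum>j<N. ?T j x - ?T (Suc j) x)"
      unfolding G_def sum_subtractf sum_distrib_left step ..
    also have "\<dots> = ?T 0 x - ?T N x" by (rule sum_lessThan_telescope')
    finally show ?thesis .
  qed
  then have "f x - test_fun (G N) x = complex_of_real (q ^ N) * f (x + real N / \<alpha>)" for N x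
    by (simp add: test_fun_def)
  then have n: "L2norm_sq (\<lambda>x. f x - test_fun (G N) x) = (q ^ N)\<^sup>2 * L2norm_sq f" for N
    using L2_cmult(2)[OF L2_shift(1)[OF f], of "complex_of_real (q ^ N)"] q_bounds
    by (simp add: L2_shift(2)[OF f] norm_power)
  have "(\<lambda>N. (q ^ N)\<^sup>2 * L2norm_sq f) \<longlonglongrightarrow> 0\<^sup>2 * L2norm_sq f"
    by (intro tendsto_intros LIMSEQ_realpow_zero) (use q_bounds in auto)
  then have "eventually (\<lambda>N. (q ^ N)\<^sup>2 * L2norm_sq f < \<epsilon>) sequentially"
    using \<epsilon> by (intro order_tendstoD(2)) auto
  then obtain N where "(q ^ N)\<^sup>2 * L2norm_sq f < \<epsilon>" by (auto simp: eventually_sequentially)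
  then show "\<exists>d\<in>test_fun ` Collect L2. L2norm_sq (\<lambda>x. f x - d x) < \<epsilon>"
    using GL[of N] n[of N] by (intro bexI[of _ "test_fun (G N)"]) auto
qed

lemma frame_gabor_hat_iff:
  "frame (\<lambda>(m, n). gabor_hat m n) \<longleftrightarrow>
    (\<exists>c C. c > 0 \<and> C > 0 \<and> (\<forall>G. L2 G \<longrightarrow>
       ennreal (c * L2norm_sq G) \<le> shift_sum G \<and> shift_sum G \<le> ennreal (C * L2norm_sq G)))"
  (is "?frame \<longleftrightarrow> ?shift")
proof -
  let ?S = "\<lambda>G. frame_sum (\<lambda>(m, n). gabor_hat m n) (test_fun G)"
  define k1 where "k1 = 4 * pi\<^sup>2 / \<alpha>"
  define k2 where "k2 = exp (- 4 * pi * w / \<alpha>) * \<alpha> / (4 * pi\<^sup>2)"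
  have k: "k1 > 0" "k2 > 0" using \<alpha> by (auto simp: k1_def k2_def)
  have SR: "?S G \<le> ennreal k1 * shift_sum G" and RS: "shift_sum G \<le> ennreal k2 * ?S G" if "L2 G" for G
    unfolding k1_def k2_def using that by (rule frame_sum_le_shift_sum shift_sum_le_frame_sum)+
  have q0: "(1 - q)\<^sup>2 > 0" using q_bounds by simp
  have cancel: "ennreal (x / k) \<le> R" if "ennreal x \<le> ennreal k * R" "k > 0" for x k :: real and R
  proof -
    have "ennreal (1 / k) * ennreal x \<le> ennreal (1 / k) * (ennreal k * R)"
      using that(1) by (rule mult_left_mono) simp
    moreover have "ennreal (1 / k) * ennreal x = ennreal (x / k)"
      using that(2) by (subst ennreal_mult'[symmetric]) auto
    moreover have "ennreal (1 / k) * (ennreal k * R) = R"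
      using that(2) by (simp add: mult.assoc[symmetric] ennreal_mult'[symmetric])
    ultimately show ?thesis by simp
  qed
  have scale: "ennreal k * R \<le> ennreal (k * x)" if "R \<le> ennreal x" "k > 0" for x k :: real and R
    using mult_left_mono[OF that(1), of "ennreal k"] that(2) by (simp add: ennreal_mult')
  have "?frame \<longleftrightarrow> frame_on (test_fun ` Collect L2) (\<lambda>(m, n). gabor_hat m n)"
    by (rule frame_on_dense[OF L2_dense_test_fun]) (auto simp: gabor_hat_L2)
  also have "\<dots> \<longleftrightarrow> ?shift"
  proof
    assume "frame_on (test_fun ` Collect L2) (\<lambda>(m, n). gabor_hat m n)"
    then obtain A B where A: "A > 0" and B: "B > 0"
      and AB: "\<And>G. L2 G \<Longrightarrow> ennreal (A * L2norm_sq (test_fun G)) \<le> ?S G"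
        "\<And>G. L2 G \<Longrightarrow> ?S G \<le> ennreal (B * L2norm_sq (test_fun G))"
      unfolding frame_on_def by auto
    \<comment> \<open>The constants combine two comparisons: \<open>test_fun_L2\<close> bounds the
      norm of \<open>test_fun G\<close> by that of \<open>G\<close> from above with 4 and from below
      with (1 - q)^2, while \<open>k1\<close> and \<open>k2\<close> convert between the two sums. In
      the converse direction 4 and (1 - q)^2 exchange their places.\<close>
    show ?shift
    proof (rule exI[of _ "A * (1 - q)\<^sup>2 / k1"], rule exI[of _ "k2 * (B * 4)"], intro conjI allI impI)
      fix G assume G: "L2 G"
      have "ennreal (A * ((1 - q)\<^sup>2 * L2norm_sq G)) \<le> ennreal (A * L2norm_sq (test_fun G))"
        using A by (intro ennreal_leI mult_left_mono test_fun_L2(3) G) auto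
      also note AB(1)[OF G]
      also note SR[OF G]
      finally have "ennreal (A * ((1 - q)\<^sup>2 * L2norm_sq G) / k1) \<le> shift_sum G" using k(1) by (rule cancel)
      then show "ennreal (A * (1 - q)\<^sup>2 / k1 * L2norm_sq G) \<le> shift_sum G" by (simp add: mult.assoc)
      have "?S G \<le> ennreal (B * (4 * L2norm_sq G))"
        using B by (intro order_trans[OF AB(2)[OF G]] ennreal_leI mult_left_mono test_fun_L2(2) G) auto
      from order_trans[OF RS[OF G] scale[OF this k(2)]]
      show "shift_sum G \<le> ennreal (k2 * (B * 4) * L2norm_sq G)" by (simp add: mult.assoc)
    qed (use A B k q0 in simp_all)
  next
    assume ?shift
    then obtain c C where c: "c > 0" and C: "C > 0"
      and cC: "\<And>G. L2 G \<Longrightarrow> ennreal (c * L2norm_sq G) \<le> shift_sum G"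
        "\<And>G. L2 G \<Longrightarrow> shift_sum G \<le> ennreal (C * L2norm_sq G)" by blast
    have "ennreal (c / 4 / k2 * L2norm_sq (test_fun G)) \<le> ?S G \<and>
        ?S G \<le> ennreal (k1 * (C / (1 - q)\<^sup>2) * L2norm_sq (test_fun G))" if G: "L2 G" for G
    proof
      have "c / 4 * L2norm_sq (test_fun G) \<le> c / 4 * (4 * L2norm_sq G)"
        using c by (intro mult_left_mono test_fun_L2(2) G) auto
      then have "ennreal (c / 4 * L2norm_sq (test_fun G)) \<le> ennreal (c * L2norm_sq G)"
        by (intro ennreal_leI) simp
      also note cC(1)[OF G]
      also note RS[OF G]
      finally have "ennreal (c / 4 * L2norm_sq (test_fun G) / k2) \<le> ?S G" using k(2) by (rule cancel)
      then show "ennreal (c / 4 / k2 * L2norm_sq (test_fun G)) \<le> ?S G" by simp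
      have "L2norm_sq G \<le> L2norm_sq (test_fun G) / (1 - q)\<^sup>2"
        using test_fun_L2(3)[OF G] q0 by (simp add: pos_le_divide_eq mult.commute)
      then have "shift_sum G \<le> ennreal (C * (L2norm_sq (test_fun G) / (1 - q)\<^sup>2))"
        using C by (intro order_trans[OF cC(2)[OF G]] ennreal_leI mult_left_mono) auto
      from order_trans[OF SR[OF G] scale[OF this k(1)]]
      show "?S G \<le> ennreal (k1 * (C / (1 - q)\<^sup>2) * L2norm_sq (test_fun G))" by (simp add: mult.assoc)
    qed
    moreover have "c / 4 / k2 > 0" "k1 * (C / (1 - q)\<^sup>2) > 0" using c C k q0 by auto
    ultimately show "frame_on (test_fun ` Collect L2) (\<lambda>(m, n). gabor_hat m n)"
      unfolding frame_on_def
      by - (rule exI[of _ "c / 4 / k2"], rule exI[of _ "k1 * (C / (1 - q)\<^sup>2)"], auto)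
  qed
  finally show ?thesis .
qed

end

theorem theorem3:
  fixes \<alpha> w :: real and a :: "nat \<Rightarrow> complex" and b :: "nat \<Rightarrow> real"
    and g :: "real \<Rightarrow> complex"
  assumes "\<alpha> > 0" and "w < 0"
    and "summable (\<lambda>k. norm (a k))"
    and "\<And>k. b k \<ge> 0"
    and "\<And>t. g t = (\<Sum>k. a k * exp (complex_of_real (2 * pi * b k * t) * \<i>)) / (complex_of_real t - \<i> * complex_of_real w)"
  shows "frame (\<lambda>(m, n). gabor g \<alpha> m n) \<longleftrightarrow>
    (\<exists>c C. c > 0 \<and> C > 0 \<and> (\<forall>G. L2 G \<longrightarrow>
       ennreal (c * L2norm_sq G) \<le>
         (\<integral>\<^sup>+ m. (\<integral>\<^sup>+ t\<in>{0..1/\<alpha>}.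
            ennreal ((norm (\<Sum>k. a k * A_op \<alpha> w (b k) (\<lambda>s. G (s + real_of_int m + b k)) t))\<^sup>2) \<partial>lborel)
          \<partial>count_space (UNIV :: int set)) \<and>
       (\<integral>\<^sup>+ m. (\<integral>\<^sup>+ t\<in>{0..1/\<alpha>}.
            ennreal ((norm (\<Sum>k. a k * A_op \<alpha> w (b k) (\<lambda>s. G (s + real_of_int m + b k)) t))\<^sup>2) \<partial>lborel)
          \<partial>count_space (UNIV :: int set)) \<le> ennreal (C * L2norm_sq G)))"
proof -
  interpret rational_window \<alpha> w a b g
    by unfold_locales (fact assms)+
  show ?thesis
    unfolding frame_gabor_iff_frame_gabor_hat frame_gabor_hat_iff shift_sum_def ..
qed

end
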